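(* Consider a stable matching instance with men $m_1,\dots,m_M$ and women $w_1,\dots,w_W$. Each person's set of acceptable partners is fixed. Each woman independently draws the ordering of her acceptable men from a regular distribution, and the men's preference lists are arbitrary (fixed). For every integer $k\ge 1$ let \[u_k=\max\left\{\frac{\Pr[m_{i+k}\succ_w m_i]}{\Pr[m_i\succ_w m_{i+k}]}\;:\; w \text{ a woman},\ i\ge 1,\ i+k\le M,\ w \text{ finds both } m_i \text{ and } m_{i+k} \text{ acceptable}\right\}.\] Then for every woman $w$, conditioned on $w$ having at least one stable partner, the expected difference between the ranks, in $w$'s preference list, of her least preferred and her most preferred stable partners is at most \[\Big(1+2\exp\big(\textstyle\sum_{k\ge 1}k u_k\big)\Big)\sum_{k\ge 1}k^2u_k .\]
   Context: A matching pairs some men with some women one-to-one; the others are single. Each man $m$ has a strict total order $\succ_m$ on $\mathcal W\cup\{m\}$. A woman $w$ is acceptable to $m$ iff $w\succ_m m$. Women's orders $\succ_w$ on $\mathcal M\cup\{w\}$ are defined symmetrically. A pair $(m,w)$ blocks a matching $\mu$ if $m\succ_w\mu(w)$ and $w\succ_m\mu(m)$, where $\mu(p)=p$ if $p$ is single. A person $p$ also blocks $\mu$ if $\mu(p)$ is unacceptable to $p$. A matching is stable if nothing blocks it. A stable partner of $p$ is someone matched to $p$ in some stable matching. The rank of a man in $w$'s list is his position among her acceptable men. A distribution of preference lists (over a fixed acceptable set) is regular if for every sequence of distinct acceptable partners $a_1,\dots,a_k$ one has $\Pr[a_1\succ a_2\mid a_2\succ a_3\succ\dots\succ a_k]\le\Pr[a_1\succ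 a_2]$. *)

theory Defs
  imports "HOL-Probability.Probability"
begin

datatype person = Man nat | Woman nat

definition men :: "nat \<Rightarrow> person set" where
  "men M = Man ` {1..M}"

definition women :: "nat \<Rightarrow> person set" where
  "women W = Woman ` {1..W}"

fun opposite :: "nat \<Rightarrow> nat \<Rightarrow> person \<Rightarrow> person set" where
  "opposite M W (Man _) = women W"
| "opposite M W (Woman _) = men M"

text \<open>
  A preference order of \<open>p\<close> is a relation in which \<open>(a, b)\<close> means that \<open>p\<close> strictly prefers
  \<open>a\<close> to \<open>b\<close>; it compares \<open>p\<close> itself with everyone on the other side.
\<close>

definition pref_order :: "nat \<Rightarrow> nat \<Rightarrow> person \<Rightarrow> person rel \<Rightarrow> bool" where
  "pref_order M W p r \<longleftrightarrow>
     r \<subseteq> insert p (opposite M W p) \<times> insert p (opposite M W p) \<and>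
     strict_linear_order_on (insert p (opposite M W p)) r"

definition acceptable :: "person rel \<Rightarrow> person \<Rightarrow> person set" where
  "acceptable r p = {q. (q, p) \<in> r}"

text \<open>
  A matching is an involution on the participants; \<open>\<mu> p = p\<close> means that \<open>p\<close> is single.
\<close>

definition matching :: "nat \<Rightarrow> nat \<Rightarrow> (person \<Rightarrow> person) \<Rightarrow> bool" where
  "matching M W \<mu> \<longleftrightarrow>
     (\<forall>p \<in> men M \<union> women W. \<mu> p \<in> insert p (opposite M W p) \<and> \<mu> (\<mu> p) = p)"

definition pair_blocks ::
    "(person \<Rightarrow> person rel) \<Rightarrow> (person \<Rightarrow> person) \<Rightarrow> person \<Rightarrow> person \<Rightarrow> bool" where
  "pair_blocks R \<mu> m w \<longleftrightarrow> (m, \<mu> w) \<in> R w \<and> (w, \<mu> m) \<in> R m"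

definition person_blocks ::
    "(person \<Rightarrow> person rel) \<Rightarrow> (person \<Rightarrow> person) \<Rightarrow> person \<Rightarrow> bool" where
  "person_blocks R \<mu> p \<longleftrightarrow> \<mu> p \<noteq> p \<and> \<mu> p \<notin> acceptable (R p) p"

definition stable ::
    "nat \<Rightarrow> nat \<Rightarrow> (person \<Rightarrow> person rel) \<Rightarrow> (person \<Rightarrow> person) \<Rightarrow> bool" where
  "stable M W R \<mu> \<longleftrightarrow> matching M W \<mu> \<and>
     (\<forall>m \<in> men M. \<forall>w \<in> women W. \<not> pair_blocks R \<mu> m w) \<and>
     (\<forall>p \<in> men M \<union> women W. \<not> person_blocks R \<mu> p)"

definition stable_partners ::
    "nat \<Rightarrow> nat \<Rightarrow> (person \<Rightarrow> person rel) \<Rightarrow> person \<Rightarrow> person set" where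
  "stable_partners M W R p = {q. q \<noteq> p \<and> (\<exists>\<mu>. stable M W R \<mu> \<and> \<mu> p = q)}"

definition rank :: "person rel \<Rightarrow> person \<Rightarrow> person \<Rightarrow> nat" where
  "rank r p a = card {b \<in> acceptable r p. (b, a) \<in> r} + 1"

definition most_preferred :: "person rel \<Rightarrow> person set \<Rightarrow> person" where
  "most_preferred r S = (THE a. a \<in> S \<and> (\<forall>b \<in> S. b \<noteq> a \<longrightarrow> (a, b) \<in> r))"

definition least_preferred :: "person rel \<Rightarrow> person set \<Rightarrow> person" where
  "least_preferred r S = (THE a. a \<in> S \<and> (\<forall>b \<in> S. b \<noteq> a \<longrightarrow> (b, a) \<in> r))"

definition stable_rank_gap :: "nat \<Rightarrow> nat \<Rightarrow> (person \<Rightarrow> person rel) \<Rightarrow> person \<Rightarrow> real" where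
  "stable_rank_gap M W R p =
     real (rank (R p) p (least_preferred (R p) (stable_partners M W R p))) -
     real (rank (R p) p (most_preferred (R p) (stable_partners M W R p)))"

text \<open>
  Only chains of positive probability constrain the distribution:
  \<^const>\<open>cond_prob\<close> is \<open>0\<close> when the conditioning event is null.
\<close>

definition regular :: "person set \<Rightarrow> person rel pmf \<Rightarrow> bool" where
  "regular A D \<longleftrightarrow>
     (\<forall>a b cs. distinct (a # b # cs) \<and> set (a # b # cs) \<subseteq> A \<longrightarrow>
        cond_prob (measure_pmf D) (\<lambda>r. (a, b) \<in> r)
          (\<lambda>r. successively (\<lambda>x y. (x, y) \<in> r) (b # cs))
        \<le> measure_pmf.prob D {r. (a, b) \<in> r})"

fun profile ::
    "(nat \<Rightarrow> person rel) \<Rightarrow> (nat \<Rightarrow> person rel) \<Rightarrow> person \<Rightarrow> person rel" where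
  "profile P Q (Man i) = P i"
| "profile P Q (Woman j) = Q j"

definition random_profile ::
    "nat \<Rightarrow> (nat \<Rightarrow> person rel) \<Rightarrow> (nat \<Rightarrow> person rel pmf) \<Rightarrow>
     (person \<Rightarrow> person rel) pmf" where
  "random_profile W P D = map_pmf (profile P) (Pi_pmf {1..W} {} D)"

text \<open>
  The ratios live in \<^typ>\<open>ennreal\<close>: a ratio with denominator \<open>0\<close> (hence numerator \<open>1\<close>) is
  \<open>\<infinity>\<close>. The inserted \<open>0\<close> matters only if no ratio exists, in particular for \<open>k \<ge> M\<close>.
\<close>

definition max_swap_ratio ::
    "nat \<Rightarrow> nat \<Rightarrow> (nat \<Rightarrow> person set) \<Rightarrow> (nat \<Rightarrow> person rel pmf) \<Rightarrow> nat \<Rightarrow> ennreal" where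
  "max_swap_ratio M W A D k = Max (insert 0
     {emeasure (measure_pmf (D j)) {r. (Man (i + k), Man i) \<in> r} /
      emeasure (measure_pmf (D j)) {r. (Man i, Man (i + k)) \<in> r} | i j.
      j \<in> {1..W} \<and> 1 \<le> i \<and> i + k \<le> M \<and> Man i \<in> A j \<and> Man (i + k) \<in> A j})"

definition exp_ennreal :: "ennreal \<Rightarrow> ennreal" where
  "exp_ennreal x = (if x = \<infinity> then \<infinity> else ennreal (exp (enn2real x)))"

end

theory Submission
  imports Defs
begin

text \<open>
  Fix the man-optimal stable matching \<open>\<mu>\<close> together with the order of every woman on the acceptable men
  who weakly prefer her to their partner in \<open>\<mu>\<close> (the men who propose to her in deferred
  acceptance). This event is a product over the women, so conditioned on it their lists stay
  independent, and regularity says that a woman prefers a given further man to her partner with at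
  most the unconditional probability.

  Let \<open>X\<^sub>i\<close> be the largest \<open>k\<close> such that the partner of man \<open>i\<close> prefers man \<open>i + k\<close> to him. If every
  \<open>i \<le> t\<close> has \<open>i + X\<^sub>i \<le> t\<close>, then every stable matching matches the men up to \<open>t\<close> with the same
  women. So if the partner of man \<open>n\<close> is \<open>w\<close> and \<open>l < n \<le> r\<close> are two such thresholds, all stable
  partners of \<open>w\<close> have index in \<open>(l, r]\<close>, and since \<open>n\<close> is her worst one, her rank gap is at most
  \<open>r - l - 1\<close> plus the number of pairs \<open>c \<le> l < b\<close> with \<open>b\<close> preferred to \<open>c\<close> preferred to \<open>n\<close>.
  The pairs contribute at most \<open>\<Sum> k u\<^sub>k\<close>. The nearest thresholds on either side are reached by
  repeatedly extending an interval along jumps; each extension stops with probability at least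
  \<open>exp (- \<Sum> k u\<^sub>k)\<close> and has expected length at most \<open>\<Sum> k\<^sup>2 u\<^sub>k\<close>.
\<close>

section \<open>Finitely supported distributions\<close>

lemma finite_set_Pi_pmf:
  assumes "finite I" "\<And>i. i \<in> I \<Longrightarrow> finite (set_pmf (p i))"
  shows "finite (set_pmf (Pi_pmf I d p))"
  using assms by (auto simp: set_Pi_pmf)

lemma set_Pi_pmfD:
  assumes "Q \<in> set_pmf (Pi_pmf I d p)" "finite I" "i \<in> I"
  shows "Q i \<in> set_pmf (p i)"
  using assms by (auto simp: set_Pi_pmf PiE_dflt_def)

lemma expectation_mono_finite:
  fixes f g :: "'a \<Rightarrow> real"
  assumes "finite (set_pmf p)" "\<And>x. x \<in> set_pmf p \<Longrightarrow> f x \<le> g x"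
  shows "measure_pmf.expectation p f \<le> measure_pmf.expectation p g"
  using assms by (intro integral_mono_AE integrable_measure_pmf_finite)
    (auto simp: AE_measure_pmf_iff)

lemma prob_eq_sum_Int_set_pmf:
  assumes "finite (set_pmf p)"
  shows "measure_pmf.prob p X = (\<Sum>x\<in>set_pmf p \<inter> X. pmf p x)"
  using assms by (subst measure_Int_set_pmf[symmetric])
    (simp add: Int_commute measure_measure_pmf_finite)

text \<open>Clearing the denominator leaves an inequality between sums over the support, which can
  be added up over the cells of a partition.\<close>

lemma expectation_cond_pmf_le_iff:
  fixes f :: "'a \<Rightarrow> real"
  assumes fin: "finite (set_pmf p)" and ne: "set_pmf p \<inter> H \<noteq> {}"
  shows "measure_pmf.expectation (cond_pmf p H) f \<le> K \<longleftrightarrow>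
    (\<Sum>x\<in>set_pmf p \<inter> H. pmf p x * f x) \<le> K * (\<Sum>x\<in>set_pmf p \<inter> H. pmf p x)"
proof -
  have P: "measure_pmf.prob p H = (\<Sum>x\<in>set_pmf p \<inter> H. pmf p x)"
    using fin by (rule prob_eq_sum_Int_set_pmf)
  have pos: "measure_pmf.prob p H > 0"
    using ne by (auto intro: measure_pmf_posI)
  have "measure_pmf.expectation (cond_pmf p H) f =
      (\<Sum>x\<in>set_pmf p \<inter> H. pmf (cond_pmf p H) x * f x)"
    using fin ne by (subst integral_measure_pmf[of "set_pmf p \<inter> H"]) auto
  also have "\<dots> = (\<Sum>x\<in>set_pmf p \<inter> H. pmf p x * f x) / measure_pmf.prob p H"
    using ne by (simp add: pmf_cond sum_divide_distrib)
  finally show ?thesis using pos unfolding P by (simp add: pos_divide_le_eq)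
qed

text \<open>Law of total expectation, with \<open>key\<close> labelling the cells: the inequality
  without denominators is additive over them.\<close>

lemma expectation_cond_pmf_partition:
  fixes f :: "'a \<Rightarrow> real"
  assumes fin: "finite (set_pmf p)" and ne: "set_pmf p \<inter> H \<noteq> {}"
    and le: "\<And>x. x \<in> set_pmf p \<inter> H \<Longrightarrow>
      measure_pmf.expectation (cond_pmf p {y \<in> H. key y = key x}) f \<le> K"
  shows "measure_pmf.expectation (cond_pmf p H) f \<le> K"
proof -
  let ?S = "set_pmf p \<inter> H"
  have fS: "finite ?S" using fin by simp
  have *: "(\<Sum>y\<in>{y \<in> ?S. key y = k}. pmf p y * f y) \<le> K * (\<Sum>y\<in>{y \<in> ?S. key y = k}. pmf p y)"
    if k: "k \<in> key ` ?S" for k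
  proof -
    obtain x where x: "x \<in> ?S" "k = key x" using k by blast
    have "set_pmf p \<inter> {y \<in> H. key y = key x} = {y \<in> ?S. key y = k}" using x by auto
    moreover have "set_pmf p \<inter> {y \<in> H. key y = key x} \<noteq> {}" using x by auto
    ultimately show ?thesis using le[OF x(1)] unfolding x(2) by (subst (asm) expectation_cond_pmf_le_iff[OF fin]) auto
  qed
  have "(\<Sum>y\<in>?S. pmf p y * f y) = (\<Sum>k\<in>key ` ?S. \<Sum>y\<in>{y \<in> ?S. key y = k}. pmf p y * f y)"
    by (rule sum.image_gen[OF fS])
  also have "\<dots> \<le> (\<Sum>k\<in>key ` ?S. K * (\<Sum>y\<in>{y \<in> ?S. key y = k}. pmf p y))"
    by (intro sum_mono *)
  also have "\<dots> = K * (\<Sum>y\<in>?S. pmf p y)"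
    unfolding sum.image_gen[OF fS, of "pmf p" key] by (rule sum_distrib_left[symmetric])
  finally show ?thesis using expectation_cond_pmf_le_iff[OF fin ne] by blast
qed

text \<open>Conditioning sees an event only through its trace on the support, so it may be replaced
  by an almost surely equivalent one.\<close>

lemma cond_pmf_eqI:
  assumes "set_pmf p \<inter> S = set_pmf p \<inter> T" "set_pmf p \<inter> S \<noteq> {}"
  shows "cond_pmf p S = cond_pmf p T"
proof (rule pmf_eqI)
  fix x
  have "measure_pmf.prob p S = measure_pmf.prob p T"
    by (metis assms(1) Int_commute measure_Int_set_pmf)
  moreover have "x \<in> set_pmf p \<Longrightarrow> x \<in> S \<longleftrightarrow> x \<in> T" using assms(1) by blast
  ultimately show "pmf (cond_pmf p S) x = pmf (cond_pmf p T) x"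
    using assms by (auto simp: pmf_cond set_pmf_iff)
qed

text \<open>The probability of a product event factorises, and so does the conditional law. This
  keeps the women's lists independent after conditioning.\<close>

lemma cond_pmf_Pi_pmf:
  assumes fin: "finite I" and ne: "\<And>i. i \<in> I \<Longrightarrow> set_pmf (p i) \<inter> B i \<noteq> {}"
  shows "cond_pmf (Pi_pmf I d p) (Pi I B) = Pi_pmf I d (\<lambda>i. cond_pmf (p i) (B i))"
proof (rule pmf_eqI)
  fix Q
  have "\<forall>i\<in>I. \<exists>x. x \<in> set_pmf (p i) \<inter> B i" using ne by blast
  then obtain g where g: "\<And>i. i \<in> I \<Longrightarrow> g i \<in> set_pmf (p i) \<inter> B i"
    using bchoice[of I "\<lambda>i x. x \<in> set_pmf (p i) \<inter> B i"] by blast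
  have "(\<lambda>i. if i \<in> I then g i else d) \<in> set_pmf (Pi_pmf I d p) \<inter> Pi I B"
    using g fin by (auto simp: set_Pi_pmf PiE_dflt_def)
  then have ne': "set_pmf (Pi_pmf I d p) \<inter> Pi I B \<noteq> {}" by blast
  have P: "measure_pmf.prob (Pi_pmf I d p) (Pi I B) = (\<Prod>i\<in>I. measure_pmf.prob (p i) (B i))"
    by (rule measure_Pi_pmf_Pi[OF fin])
  show "pmf (cond_pmf (Pi_pmf I d p) (Pi I B)) Q = pmf (Pi_pmf I d (\<lambda>i. cond_pmf (p i) (B i))) Q"
  proof (cases "\<forall>i. i \<notin> I \<longrightarrow> Q i = d")
    case True
    show ?thesis
    proof (cases "Q \<in> Pi I B")
      case QB: True
      have "(\<Prod>i\<in>I. pmf (cond_pmf (p i) (B i)) (Q i)) =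
          (\<Prod>i\<in>I. pmf (p i) (Q i) / measure_pmf.prob (p i) (B i))"
        using QB ne by (intro prod.cong) (auto simp: pmf_cond)
      then show ?thesis using True QB
        by (simp add: pmf_cond[OF ne'] P pmf_Pi[OF fin] prod_dividef)
    next
      case QB: False
      then obtain i where "i \<in> I" "Q i \<notin> B i" by auto
      then have "(\<Prod>i\<in>I. pmf (cond_pmf (p i) (B i)) (Q i)) = 0"
        using fin ne by (intro prod_zero) (auto simp: pmf_cond intro!: bexI[of _ i])
      then show ?thesis using True QB by (simp add: pmf_cond[OF ne'] pmf_Pi[OF fin])
    qed
  qed (auto simp: pmf_cond[OF ne'] pmf_Pi[OF fin])
qed

text \<open>Fubini in both orders: the new coordinate is outermost when a scan reveals its next
  list, and innermost when one list is averaged with the others fixed.\<close>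

lemma expectation_Pi_pmf_insert:
  fixes h :: "('a \<Rightarrow> 'b) \<Rightarrow> real"
  assumes "finite I" "x \<notin> I" "\<And>i. i \<in> insert x I \<Longrightarrow> finite (set_pmf (p i))"
  shows "measure_pmf.expectation (Pi_pmf (insert x I) d p) h =
    measure_pmf.expectation (p x) (\<lambda>y. measure_pmf.expectation (Pi_pmf I d p) (\<lambda>Q. h (Q(x := y))))"
    and "measure_pmf.expectation (Pi_pmf (insert x I) d p) h =
    measure_pmf.expectation (Pi_pmf I d p) (\<lambda>Q. measure_pmf.expectation (p x) (\<lambda>y. h (Q(x := y))))"
proof -
  let ?P = "Pi_pmf I d p"
  have fP: "finite (set_pmf ?P)" using assms by (intro finite_set_Pi_pmf) auto
  have fx: "finite (set_pmf (p x))" using assms by auto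
  have E: "measure_pmf.expectation q g = (\<Sum>a\<in>set_pmf q. pmf q a * g a)"
    if "finite (set_pmf q)" for q :: "'c pmf" and g :: "'c \<Rightarrow> real"
    using that by (subst integral_measure_pmf[of "set_pmf q"]) auto
  have "measure_pmf.expectation (Pi_pmf (insert x I) d p) h =
      measure_pmf.expectation (pair_pmf (p x) ?P) (\<lambda>(y, Q). h (Q(x := y)))"
    using assms(1,2) by (simp add: Pi_pmf_insert case_prod_unfold)
  also have "\<dots> = (\<Sum>(y, Q)\<in>set_pmf (p x) \<times> set_pmf ?P. pmf (p x) y * pmf ?P Q * h (Q(x := y)))"
    using fP fx by (subst E) (auto simp: pmf_pair intro!: sum.cong)
  finally have *: "measure_pmf.expectation (Pi_pmf (insert x I) d p) h = \<dots>" .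
  show "measure_pmf.expectation (Pi_pmf (insert x I) d p) h =
    measure_pmf.expectation (p x) (\<lambda>y. measure_pmf.expectation ?P (\<lambda>Q. h (Q(x := y))))"
    unfolding * using fP fx by (simp add: E sum.cartesian_product[symmetric] sum_distrib_left mult.assoc)
  show "measure_pmf.expectation (Pi_pmf (insert x I) d p) h =
    measure_pmf.expectation ?P (\<lambda>Q. measure_pmf.expectation (p x) (\<lambda>y. h (Q(x := y))))"
    unfolding * using fP fx
    by (subst sum.cartesian_product[symmetric], subst sum.swap)
      (simp add: E sum_distrib_left mult_ac)
qed

text \<open>Injectivity keeps the selected coordinates independent; the coordinates outside the
  range of \<open>f\<close> integrate to 1.\<close>

lemma map_pmf_Pi_pmf_reindex:
  fixes p :: "'b \<Rightarrow> 'c pmf"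
  assumes fin: "finite I" "finite J" and inj: "inj_on f I" and sub: "f ` I \<subseteq> J"
  shows "map_pmf (\<lambda>Q i. if i \<in> I then Q (f i) else d) (Pi_pmf J d p) = Pi_pmf I d (\<lambda>i. p (f i))"
proof (rule pmf_eqI)
  fix q :: "'a \<Rightarrow> 'c"
  \<comment> \<open>The fibre over \<open>q\<close> is a product event: coordinates in the range of
    \<open>f\<close> are pinned, all others are free.\<close>
  define B where "B = (\<lambda>j. if j \<in> f ` I then {q (the_inv_into I f j)} else UNIV)"
  show "pmf (map_pmf (\<lambda>Q i. if i \<in> I then Q (f i) else d) (Pi_pmf J d p)) q =
      pmf (Pi_pmf I d (\<lambda>i. p (f i))) q"
  proof (cases "\<forall>i. i \<notin> I \<longrightarrow> q i = d")
    case True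
    have "(\<lambda>Q i. if i \<in> I then Q (f i) else d) -` {q} = Pi J B"
    proof (rule set_eqI)
      fix Q
      have "Q \<in> Pi J B \<longleftrightarrow> (\<forall>i\<in>I. Q (f i) = q i)"
      proof
        assume Q: "Q \<in> Pi J B"
        show "\<forall>i\<in>I. Q (f i) = q i"
        proof
          fix i assume "i \<in> I"
          then have "Q (f i) \<in> B (f i)" using Q sub by auto
          then show "Q (f i) = q i" using \<open>i \<in> I\<close> inj by (simp add: B_def the_inv_into_f_f)
        qed
      next
        assume Q: "\<forall>i\<in>I. Q (f i) = q i"
        show "Q \<in> Pi J B"
        proof
          fix j assume "j \<in> J"
          show "Q j \<in> B j"
            using Q inj by (cases "j \<in> f ` I") (auto simp: B_def the_inv_into_f_f)
        qed
      qed
      moreover have "(\<lambda>i. if i \<in> I then Q (f i) else d) = q \<longleftrightarrow> (\<forall>i\<in>I. Q (f i) = q i)"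
        using True by (auto simp: fun_eq_iff)
      ultimately show "Q \<in> (\<lambda>Q i. if i \<in> I then Q (f i) else d) -` {q} \<longleftrightarrow> Q \<in> Pi J B" by simp
    qed
    then have "pmf (map_pmf (\<lambda>Q i. if i \<in> I then Q (f i) else d) (Pi_pmf J d p)) q =
        (\<Prod>j\<in>J. measure_pmf.prob (p j) (B j))"
      by (simp add: pmf_map measure_Pi_pmf_Pi[OF fin(2)])
    also have "\<dots> = (\<Prod>j\<in>f ` I. measure_pmf.prob (p j) (B j))"
      using sub fin by (intro prod.mono_neutral_right) (auto simp: B_def)
    also have "\<dots> = (\<Prod>i\<in>I. pmf (p (f i)) (q i))"
      using inj by (simp add: prod.reindex B_def the_inv_into_f_f pmf.rep_eq)
    finally show ?thesis using True by (simp add: pmf_Pi[OF fin(1)])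
  next
    case False
    then have "(\<lambda>Q i. if i \<in> I then Q (f i) else d) -` {q} = {}" by (auto simp: fun_eq_iff)
    then show ?thesis using False by (auto simp: pmf_map pmf_Pi[OF fin(1)])
  qed
qed

section \<open>Regular distributions\<close>

text \<open>Regularity speaks of chains, so an order on a finite set has to be written as a list.
  Insertion places \<open>x\<close> between the elements above and below it.\<close>

lemma ex_sorted_wrt_strict_linear_order:
  assumes "finite S" "trans r" "irrefl r" "total_on S r"
  obtains xs where "set xs = S" "distinct xs" "sorted_wrt (\<lambda>x y. (x, y) \<in> r) xs"
proof -
  have "\<exists>xs. set xs = S \<and> distinct xs \<and> sorted_wrt (\<lambda>x y. (x, y) \<in> r) xs"
    using assms(1,4)
  proof (induction S rule: finite_induct)
    case (insert x S)
    then obtain xs where xs: "set xs = S" "distinct xs" "sorted_wrt (\<lambda>x y. (x, y) \<in> r) xs"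
      by (auto simp: total_on_def)
    let ?ys = "filter (\<lambda>y. (y, x) \<in> r) xs @ x # filter (\<lambda>y. (x, y) \<in> r) xs"
    have "set ?ys = insert x S"
      using insert.hyps insert.prems xs(1) by (auto simp: total_on_def)
    moreover have "distinct ?ys"
      using xs insert.hyps assms(2,3) by (auto simp: irrefl_def dest: transD)
    moreover have "sorted_wrt (\<lambda>x y. (x, y) \<in> r) ?ys"
      using xs assms(2) by (auto simp: sorted_wrt_append sorted_wrt_filter dest: transD)
    ultimately show ?case by blast
  qed auto
  then show thesis using that by blast
qed

text \<open>A sorted list records every comparison among its elements, so two orders that sort the
  same list agree on its set.\<close>

lemma restrict_eq_if_sorted_wrt:
  assumes "trans r" "irrefl r" "sorted_wrt (\<lambda>x y. (x, y) \<in> r) xs"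
  shows "r \<inter> set xs \<times> set xs = {(xs ! i, xs ! j) | i j. i < j \<and> j < length xs}"
proof (intro subset_antisym subsetI)
  fix z assume "z \<in> r \<inter> set xs \<times> set xs"
  then obtain i j where z: "z = (xs ! i, xs ! j)" "i < length xs" "j < length xs" "(xs ! i, xs ! j) \<in> r"
    by (auto simp: in_set_conv_nth)
  have "i < j"
  proof (rule ccontr)
    assume "\<not> i < j"
    then have "i = j \<or> (xs ! j, xs ! i) \<in> r"
      using sorted_wrt_nth_less[OF assms(3), of j i] z(2) by linarith
    then have "(xs ! i, xs ! i) \<in> r" using z(4) transD[OF assms(1)] by blast
    then show False using assms(2) by (simp add: irrefl_def)
  qed
  then show "z \<in> {(xs ! i, xs ! j) | i j. i < j \<and> j < length xs}" using z by blast
next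
  fix z assume "z \<in> {(xs ! i, xs ! j) | i j. i < j \<and> j < length xs}"
  then show "z \<in> r \<inter> set xs \<times> set xs" using assms(3) by (auto simp: sorted_wrt_iff_nth_less)
qed

lemma prob_le_mono_support:
  assumes "\<And>x. x \<in> set_pmf p \<Longrightarrow> x \<in> X \<Longrightarrow> x \<in> Y"
  shows "measure_pmf.prob p X \<le> measure_pmf.prob p Y"
  using assms by (intro measure_pmf.finite_measure_mono_AE) (auto simp: AE_measure_pmf_iff)

lemma prob_eq_support:
  assumes "\<And>x. x \<in> set_pmf p \<Longrightarrow> x \<in> X \<longleftrightarrow> x \<in> Y"
  shows "measure_pmf.prob p X = measure_pmf.prob p Y"
  using assms by (intro antisym prob_le_mono_support) auto

locale regular_order =
  fixes A :: "person set" and D :: "person rel pmf"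
  assumes regular: "regular A D"
    and finite_A: "finite A"
    and finite_D: "finite (set_pmf D)"
    and trans: "\<And>r. r \<in> set_pmf D \<Longrightarrow> trans r"
    and irrefl: "\<And>r. r \<in> set_pmf D \<Longrightarrow> irrefl r"
    and total: "\<And>r. r \<in> set_pmf D \<Longrightarrow> total_on A r"
begin

lemma asym: "r \<in> set_pmf D \<Longrightarrow> (x, y) \<in> r \<Longrightarrow> (y, x) \<notin> r"
  using trans irrefl by (meson irrefl_def transD)

lemma totalD: "r \<in> set_pmf D \<Longrightarrow> x \<in> A \<Longrightarrow> y \<in> A \<Longrightarrow> x \<noteq> y \<Longrightarrow> (y, x) \<notin> r \<Longrightarrow> (x, y) \<in> r"
  using total by (auto simp: total_on_def)

lemma prob_swap:
  assumes "a \<in> A" "b \<in> A" "a \<noteq> b"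
  shows "measure_pmf.prob D {r. (a, b) \<in> r} = 1 - measure_pmf.prob D {r. (b, a) \<in> r}"
proof -
  have "measure_pmf.prob D {r. (a, b) \<in> r} = measure_pmf.prob D (UNIV - {r. (b, a) \<in> r})"
    using assms by (intro prob_eq_support) (auto dest: asym totalD)
  then show ?thesis using measure_pmf.prob_compl[of "{r. (b, a) \<in> r}" D] by simp
qed

text \<open>Regularity multiplied out; for a null chain both sides vanish.\<close>

lemma prob_chain_le:
  assumes "distinct (a # b # cs)" "set (a # b # cs) \<subseteq> A"
  shows "measure_pmf.prob D {r. (a, b) \<in> r \<and> successively (\<lambda>x y. (x, y) \<in> r) (b # cs)}
    \<le> measure_pmf.prob D {r. (a, b) \<in> r} *
      measure_pmf.prob D {r. successively (\<lambda>x y. (x, y) \<in> r) (b # cs)}"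
    (is "?l \<le> ?p * ?q")
proof (cases "?q = 0")
  case True
  have "?l \<le> ?q" by (intro measure_pmf.finite_measure_mono) auto
  then show ?thesis using True by simp
next
  case False
  then have "?q > 0" by (simp add: zero_less_measure_iff)
  moreover have "?l / ?q \<le> ?p"
    using regular assms unfolding regular_def cond_prob_def by fastforce
  ultimately show ?thesis by (simp add: pos_divide_le_eq)
qed

text \<open>
  Summing the chain condition over all orderings of \<open>S\<close> replaces the chain by the event that
  \<open>m\<close> tops \<open>S\<close>, together with any event determined by the order on \<open>S\<close>.
\<close>

lemma prob_beats_top_le:
  assumes S: "S \<subseteq> A" "m \<in> A" "a \<in> A" "a \<noteq> m"
    and G: "\<And>r r'. r \<inter> S \<times> S = r' \<inter> S \<times> S \<Longrightarrow> G r \<longleftrightarrow> G r'"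
  shows "measure_pmf.prob D {r. (a, m) \<in> r \<and> (\<forall>s\<in>S. (m, s) \<in> r) \<and> G r}
    \<le> measure_pmf.prob D {r. (a, m) \<in> r} *
      measure_pmf.prob D {r. (\<forall>s\<in>S. (m, s) \<in> r) \<and> G r}"
    (is "?l \<le> ?p * measure_pmf.prob D ?N")
proof (cases "m \<in> S \<or> a \<in> S")
  case True
  \<comment> \<open>The event would contain \<open>(m, m)\<close> if \<open>m\<close> is in
    \<open>S\<close>, and both \<open>(a, m)\<close> and \<open>(m, a)\<close> if \<open>a\<close>
    is in \<open>S\<close>.\<close>
  then have "?l = measure_pmf.prob D {}"
    using irrefl by (intro prob_eq_support) (auto simp: irrefl_def dest: asym)
  then show ?thesis by simp
next
  case False
  have finS: "finite S" using S(1) finite_A finite_subset by blast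
  \<comment> \<open>The cells of the partition are the possible orders on \<open>S\<close>; by
    assumption \<open>G\<close> is constant on each.\<close>
  define order where "order = (\<lambda>r. r \<inter> S \<times> S :: person rel)"
  show ?thesis
  proof (cases "set_pmf D \<inter> ?N = {}")
    case True
    have "?l = measure_pmf.prob D {}"
      using True by (intro prob_eq_support) auto
    then show ?thesis by simp
  next
    case ne: False
    have "measure_pmf.expectation (cond_pmf D ?N) (indicator {r. (a, m) \<in> r}) \<le> ?p"
    proof (rule expectation_cond_pmf_partition[OF finite_D ne, where key = order])
      fix r0 assume r0: "r0 \<in> set_pmf D \<inter> ?N"
      then have "trans r0" "irrefl r0" "total_on S r0"
        using trans irrefl total_on_subset[OF total S(1)] by blast+
      then obtain xs where xs: "set xs = S" "distinct xs" "sorted_wrt (\<lambda>x y. (x, y) \<in> r0) xs"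
        by (rule ex_sorted_wrt_strict_linear_order[OF finS])
      \<comment> \<open>\<open>?K\<close> is the cell of \<open>r0\<close>, and \<open>?C\<close>
        the chain \<open>m\<close> followed by \<open>S\<close> in that order. On the support they
        coincide, because transitivity extends neighbouring comparisons to all pairs.\<close>
      let ?K = "{r \<in> ?N. order r = order r0}"
      let ?C = "{r. successively (\<lambda>x y. (x, y) \<in> r) (m # xs)}"
      have K: "r \<in> ?K \<longleftrightarrow> r \<in> ?C" if r: "r \<in> set_pmf D" for r
      proof -
        have "r \<in> ?C \<longleftrightarrow> sorted_wrt (\<lambda>x y. (x, y) \<in> r) (m # xs)"
          using trans[OF r] by (simp add: successively_conv_sorted_wrt transp_def trans_def del: sorted_wrt.simps)
        also have "\<dots> \<longleftrightarrow> (\<forall>s\<in>S. (m, s) \<in> r) \<and> sorted_wrt (\<lambda>x y. (x, y) \<in> r) xs"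
          using xs by simp
        also have "sorted_wrt (\<lambda>x y. (x, y) \<in> r) xs \<longleftrightarrow> order r = order r0"
        proof
          assume "sorted_wrt (\<lambda>x y. (x, y) \<in> r) xs"
          then show "order r = order r0"
            using restrict_eq_if_sorted_wrt[OF trans[OF r] irrefl[OF r]]
              restrict_eq_if_sorted_wrt[OF \<open>trans r0\<close> \<open>irrefl r0\<close> xs(3)]
            unfolding order_def xs(1)[symmetric] by simp
        next
          assume "order r = order r0"
          then have "r0 \<inter> S \<times> S \<subseteq> r" by (auto simp: order_def)
          then show "sorted_wrt (\<lambda>x y. (x, y) \<in> r) xs"
            by (intro sorted_wrt_mono_rel[OF _ xs(3)]) (use xs(1) in blast)
        qed
        also have "(\<forall>s\<in>S. (m, s) \<in> r) \<and> order r = order r0 \<longleftrightarrow> r \<in> ?K"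
          using G[of r r0] r0 unfolding order_def by blast
        finally show ?thesis by blast
      qed
      have neK: "set_pmf D \<inter> ?K \<noteq> {}" using r0 by auto
      have "measure_pmf.prob D {r. (a, m) \<in> r \<and> successively (\<lambda>x y. (x, y) \<in> r) (m # xs)} =
          (\<Sum>r\<in>set_pmf D \<inter> ?K. pmf D r * indicator {r. (a, m) \<in> r} r)"
        unfolding prob_eq_sum_Int_set_pmf[OF finite_D]
        using K finite_D by (intro sum.mono_neutral_cong_left) (auto simp: indicator_def)
      moreover have "measure_pmf.prob D ?C = (\<Sum>r\<in>set_pmf D \<inter> ?K. pmf D r)"
        unfolding prob_eq_sum_Int_set_pmf[OF finite_D]
        using K by (intro sum.cong) auto
      moreover have "distinct (a # m # xs)" "set (a # m # xs) \<subseteq> A"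
        using False xs S by auto
      ultimately show "measure_pmf.expectation (cond_pmf D ?K) (indicator {r. (a, m) \<in> r}) \<le> ?p"
        using prob_chain_le[of a m xs]
        by (subst expectation_cond_pmf_le_iff[OF finite_D neK]) simp
    qed
    moreover have "(\<Sum>r\<in>set_pmf D \<inter> ?N. pmf D r * indicator {r. (a, m) \<in> r} r) = ?l"
      unfolding prob_eq_sum_Int_set_pmf[OF finite_D]
      using finite_D by (intro sum.mono_neutral_cong_right) (auto simp: indicator_def)
    ultimately show ?thesis
      unfolding expectation_cond_pmf_le_iff[OF finite_D ne] prob_eq_sum_Int_set_pmf[OF finite_D, of ?N]
      by (simp only:)
  qed
qed

end

section \<open>Probabilities given that a man tops a set\<close>

lemma prob_cond_pmf:
  assumes "set_pmf p \<inter> S \<noteq> {}"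
  shows "measure_pmf.prob (cond_pmf p S) X = measure_pmf.prob p (X \<inter> S) / measure_pmf.prob p S"
proof -
  have "emeasure (measure_pmf p) S \<noteq> 0"
    using assms by (simp add: emeasure_measure_pmf_not_zero)
  then show ?thesis
    by (simp add: cond_pmf.rep_eq[OF assms] measure_uniform_measure Int_commute)
qed

text \<open>The shape in which the order of a woman on her proposers is conditioned on:
  \<open>m\<close> is her partner, \<open>C\<close> consists of the other proposers, and
  \<open>\<tau>\<close> is their order.\<close>

definition top_event :: "person \<Rightarrow> person set \<Rightarrow> person rel \<Rightarrow> person rel set" where
  "top_event m C \<tau> = {r. (\<forall>s\<in>C. (m, s) \<in> r) \<and> r \<inter> C \<times> C = \<tau>}"

context regular_order
begin

context
  fixes m :: person and C :: "person set" and \<tau> :: "person rel"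
  assumes m: "m \<in> A" and C: "C \<subseteq> A" and ne: "set_pmf D \<inter> top_event m C \<tau> \<noteq> {}"
begin

lemma prob_top_event_pos: "measure_pmf.prob D (top_event m C \<tau>) > 0"
  using ne by (auto intro: measure_pmf_posI)

text \<open>\<open>prob_beats_top_le\<close> for \<open>S = C\<close>, with the order on
  \<open>C\<close> as the determined event \<open>G\<close>.\<close>

lemma prob_beats_given_top_event:
  assumes a: "a \<in> A" "a \<noteq> m"
  shows "measure_pmf.prob (cond_pmf D (top_event m C \<tau>)) {r. (a, m) \<in> r}
    \<le> measure_pmf.prob D {r. (a, m) \<in> r}"
proof -
  have "{r. (a, m) \<in> r} \<inter> top_event m C \<tau> =
      {r. (a, m) \<in> r \<and> (\<forall>s\<in>C. (m, s) \<in> r) \<and> r \<inter> C \<times> C = \<tau>}"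
    by (auto simp: top_event_def)
  then show ?thesis
    using prob_beats_top_le[OF C m a, of "\<lambda>r. r \<inter> C \<times> C = \<tau>"] prob_top_event_pos
    unfolding prob_cond_pmf[OF ne] by (simp add: pos_divide_le_eq top_event_def)
qed

text \<open>If \<open>c\<close> is above \<open>m\<close> and \<open>m\<close> tops
  \<open>C\<close>, then \<open>c\<close> tops \<open>insert m C\<close>, and the order on that set
  determines the top event. So \<open>prob_beats_top_le\<close> applies with \<open>c\<close> as the
  top.\<close>

lemma prob_chain_given_top_event:
  assumes a: "a \<in> A" "c \<in> A" "a \<noteq> c"
  shows "measure_pmf.prob (cond_pmf D (top_event m C \<tau>)) {r. (a, c) \<in> r \<and> (c, m) \<in> r}
    \<le> measure_pmf.prob D {r. (a, c) \<in> r}"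
proof -
  let ?S = "insert m C" and ?G = "\<lambda>r. r \<in> top_event m C \<tau>"
  have G: "?G r \<longleftrightarrow> ?G r'" if eq: "r \<inter> ?S \<times> ?S = r' \<inter> ?S \<times> ?S" for r r'
  proof -
    have "(m, s) \<in> r \<longleftrightarrow> (m, s) \<in> r'" if "s \<in> C" for s using eq that by blast
    moreover have "r \<inter> C \<times> C = r' \<inter> C \<times> C" using eq by blast
    ultimately show ?thesis by (simp add: top_event_def)
  qed
  have "measure_pmf.prob D ({r. (a, c) \<in> r \<and> (c, m) \<in> r} \<inter> top_event m C \<tau>) =
      measure_pmf.prob D {r. (a, c) \<in> r \<and> (\<forall>s\<in>?S. (c, s) \<in> r) \<and> ?G r}"
    by (intro prob_eq_support) (auto simp: top_event_def intro: transD[OF trans, of _ c m])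
  also have "\<dots> \<le> measure_pmf.prob D {r. (a, c) \<in> r} *
      measure_pmf.prob D {r. (\<forall>s\<in>?S. (c, s) \<in> r) \<and> ?G r}"
    using m C by (intro prob_beats_top_le[OF _ a(2,1,3) G]) auto
  also have "\<dots> \<le> measure_pmf.prob D {r. (a, c) \<in> r} * measure_pmf.prob D (top_event m C \<tau>)"
    by (intro mult_left_mono measure_pmf.finite_measure_mono) auto
  finally show ?thesis
    using prob_top_event_pos unfolding prob_cond_pmf[OF ne] by (simp add: pos_divide_le_eq)
qed

text \<open>The men of \<open>T\<close> are added one at a time. By regularity, knowing that
  \<open>m\<close> is above the earlier ones does not raise the chance that the next one beats
  \<open>m\<close>, so the lower bounds multiply.\<close>

lemma prob_beats_all_given_top_event:
  assumes T: "finite T" "T \<subseteq> A - {m}"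
    and v: "\<And>a. a \<in> T \<Longrightarrow> exp (- v a) \<le> measure_pmf.prob D {r. (m, a) \<in> r}"
  shows "exp (- (\<Sum>a\<in>T. v a)) \<le>
    measure_pmf.prob (cond_pmf D (top_event m C \<tau>)) {r. \<forall>a\<in>T. (m, a) \<in> r}"
proof -
  let ?N = "\<lambda>T. {r. \<forall>a\<in>T. (m, a) \<in> r} \<inter> top_event m C \<tau>"
  have "exp (- (\<Sum>a\<in>T. v a)) * measure_pmf.prob D (top_event m C \<tau>) \<le> measure_pmf.prob D (?N T)"
    using T v
  proof (induction T rule: finite_induct)
    case (insert a T)
    \<comment> \<open>The men already known to be below \<open>m\<close> join \<open>C\<close> as
      the set topped by \<open>m\<close>.\<close>
    let ?S = "C \<union> T"
    have N: "?N T = {r. (\<forall>s\<in>?S. (m, s) \<in> r) \<and> r \<inter> C \<times> C = \<tau>}"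
      by (auto simp: top_event_def)
    have a: "a \<in> A" "a \<noteq> m" using insert.prems by auto
    have G: "r \<inter> C \<times> C = \<tau> \<longleftrightarrow> r' \<inter> C \<times> C = \<tau>" if "r \<inter> ?S \<times> ?S = r' \<inter> ?S \<times> ?S" for r r'
    proof -
      have "r \<inter> C \<times> C = r' \<inter> C \<times> C" using that by blast
      then show ?thesis by simp
    qed
    have "?S \<subseteq> A" using C insert.prems(1) by blast
    have aN: "{r. (a, m) \<in> r} \<inter> ?N T =
        {r. (a, m) \<in> r \<and> (\<forall>s\<in>?S. (m, s) \<in> r) \<and> r \<inter> C \<times> C = \<tau>}"
      by (auto simp: top_event_def)
    have le: "measure_pmf.prob D ({r. (a, m) \<in> r} \<inter> ?N T) \<le>
        measure_pmf.prob D {r. (a, m) \<in> r} * measure_pmf.prob D (?N T)"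
      unfolding aN unfolding N by (rule prob_beats_top_le[OF \<open>?S \<subseteq> A\<close> m a G])
    \<comment> \<open>By totality either \<open>m\<close> beats \<open>a\<close> or \<open>a\<close>
      beats \<open>m\<close>.\<close>
    have "measure_pmf.prob D (?N T) =
        measure_pmf.prob D (?N (insert a T) \<union> {r. (a, m) \<in> r} \<inter> ?N T)"
      using a m by (intro prob_eq_support) (auto dest: totalD)
    also have "\<dots> \<le> measure_pmf.prob D (?N (insert a T)) + measure_pmf.prob D ({r. (a, m) \<in> r} \<inter> ?N T)"
      by (intro measure_subadditive) auto
    finally have "measure_pmf.prob D {r. (m, a) \<in> r} * measure_pmf.prob D (?N T) \<le>
        measure_pmf.prob D (?N (insert a T))"
      using le a m by (simp add: prob_swap[of m a] algebra_simps)
    moreover have "exp (- v a) * (exp (- (\<Sum>a\<in>T. v a)) * measure_pmf.prob D (top_event m C \<tau>)) \<le>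
        measure_pmf.prob D {r. (m, a) \<in> r} * measure_pmf.prob D (?N T)"
      using insert by (intro mult_mono) auto
    moreover have "exp (- (\<Sum>a\<in>insert a T. v a)) = exp (- v a) * exp (- (\<Sum>a\<in>T. v a))"
      using insert.hyps by (simp add: exp_add[symmetric])
    ultimately show ?case by (simp only: mult.assoc)
  qed auto
  then show ?thesis
    using prob_top_event_pos unfolding prob_cond_pmf[OF ne] by (simp add: pos_le_divide_eq)
qed

end

end

section \<open>Extending an interval along random jumps\<close>

text \<open>
  \<open>right_end X a b k\<close> scans the points \<open>a + 1, \<dots>, a + k\<close> upwards, \<open>b\<close> being the end reached so
  far; \<open>left_end X a i\<close> scans \<open>i, \<dots>, 1\<close> downwards, \<open>a\<close> being the leftmost point absorbed so far.
  In both cases a potential that bounds the expected remaining extension decreases at every step.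
\<close>

fun right_end :: "(nat \<Rightarrow> nat) \<Rightarrow> nat \<Rightarrow> nat \<Rightarrow> nat \<Rightarrow> nat" where
  "right_end X a b 0 = b"
| "right_end X a b (Suc k) =
     right_end X (Suc a) (if a < b then max b (Suc a + X (Suc a)) else b) k"

fun left_end :: "(nat \<Rightarrow> nat) \<Rightarrow> nat \<Rightarrow> nat \<Rightarrow> nat" where
  "left_end X a 0 = a"
| "left_end X a (Suc i) = left_end X (if a \<le> Suc i + X (Suc i) then Suc i else a) i"

lemma right_end_ge: "b \<le> right_end X a b k"
  by (induction X a b k rule: right_end.induct) (auto split: if_splits)

lemma right_end_stop: "b \<le> a \<Longrightarrow> right_end X a b k = b"
  by (induction X a b k rule: right_end.induct) auto

text \<open>A scanned point that lies below the final end was below the current end when scanned,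
  since the scan absorbs nothing after passing the end. Its jump therefore entered the
  maximum.\<close>

lemma right_end_closed:
  "a < i \<Longrightarrow> i \<le> a + k \<Longrightarrow> i \<le> right_end X a b k \<Longrightarrow> i + X i \<le> right_end X a b k"
proof (induction k arbitrary: a b)
  case (Suc k)
  show ?case
  proof (cases "i = Suc a")
    case True
    then have "a < b" using Suc.prems right_end_stop[of b a X "Suc k"] by linarith
    then show ?thesis
      using True right_end_ge[of "max b (Suc a + X (Suc a))" X "Suc a" k] by simp
  qed (use Suc in auto)
qed simp

lemma right_end_cong:
  "(\<And>i. a < i \<Longrightarrow> i \<le> a + k \<Longrightarrow> X i = Y i) \<Longrightarrow> right_end X a b k = right_end Y a b k"
proof (induction k arbitrary: a b)
  case (Suc k)
  have "X (Suc a) = Y (Suc a)" using Suc.prems by simp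
  moreover have "right_end X (Suc a) b' k = right_end Y (Suc a) b' k" for b'
    using Suc.prems by (intro Suc.IH) auto
  ultimately show ?case by simp
qed simp

lemma left_end_le: "i < a \<Longrightarrow> left_end X a i = a \<or> left_end X a i \<le> i"
proof (induction i arbitrary: a)
  case (Suc i)
  show ?case
  proof (cases "a \<le> Suc i + X (Suc i)")
    case True
    then show ?thesis using Suc.IH[of "Suc i"] by auto
  next
    case False
    then show ?thesis using Suc.IH[of a] Suc.prems by auto
  qed
qed simp

lemma left_end_pos: "0 < a \<Longrightarrow> 0 < left_end X a i"
  by (induction i arbitrary: a) auto

text \<open>If \<open>j\<close> lies left of the final end, neither \<open>j\<close> nor a smaller
  point was absorbed. So the final end was already reached when \<open>j\<close> was scanned, and
  the jump of \<open>j\<close> fell short of it.\<close>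

lemma left_end_closed:
  "i < a \<Longrightarrow> 0 < j \<Longrightarrow> j \<le> i \<Longrightarrow> j < left_end X a i \<Longrightarrow> j + X j < left_end X a i"
proof (induction i arbitrary: a)
  case (Suc i)
  define a' where "a' = (if a \<le> Suc i + X (Suc i) then Suc i else a)"
  have eq: "left_end X a (Suc i) = left_end X a' i" by (simp add: a'_def)
  have "i < a'" using Suc.prems(1) by (simp add: a'_def)
  show ?case
  proof (cases "j = Suc i")
    case True
    then have "left_end X a' i = a'" "a' = a"
      using left_end_le[OF \<open>i < a'\<close>, of X] Suc.prems eq by (auto simp: a'_def split: if_splits)
    then show ?thesis using True eq Suc.prems by (auto simp: a'_def split: if_splits)
  next
    case False
    then show ?thesis using Suc.IH[OF \<open>i < a'\<close>] Suc.prems eq by simp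
  qed
qed simp

lemma left_end_cong:
  "(\<And>j. 0 < j \<Longrightarrow> j \<le> i \<Longrightarrow> X j = Y j) \<Longrightarrow> left_end X a i = left_end Y a i"
  by (induction i arbitrary: a) auto

section \<open>The potential argument for random jumps\<close>

lemma double_sum_weights_le:
  fixes c :: "nat \<Rightarrow> nat \<Rightarrow> real"
  assumes "finite I" "\<And>k. 0 \<le> u k"
    and "\<And>k. 1 \<le> k \<Longrightarrow> card {e \<in> I. R e k} \<le> k"
    and "\<And>e k. e \<in> I \<Longrightarrow> R e k \<Longrightarrow> c e k \<le> C k" "\<And>k. 0 \<le> C k"
  shows "(\<Sum>e\<in>I. \<Sum>k\<in>{k\<in>{1..M::nat}. R e k}. c e k * u k) \<le> (\<Sum>k=1..M. real k * (C k * u k))"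
proof -
  \<comment> \<open>After the exchange each \<open>k\<close> occurs for at most \<open>k\<close>
    values of \<open>e\<close>.\<close>
  have "(\<Sum>e\<in>I. \<Sum>k\<in>{k\<in>{1..M}. R e k}. c e k * u k) =
      (\<Sum>k=1..M. \<Sum>e\<in>{e\<in>I. R e k}. c e k * u k)"
    using assms(1) by (intro sum.swap_restrict) auto
  also have "\<dots> \<le> (\<Sum>k=1..M. real k * (C k * u k))"
  proof (rule sum_mono)
    fix k assume "k \<in> {1..M}"
    then have "1 \<le> k" by simp
    have "(\<Sum>e\<in>{e\<in>I. R e k}. c e k * u k) \<le> real (card {e\<in>I. R e k}) * (C k * u k)"
      using assms(2,4) by (intro sum_bounded_above mult_right_mono) auto
    also have "\<dots> \<le> real k * (C k * u k)"
      using assms(2,5) assms(3)[OF \<open>1 \<le> k\<close>] by (intro mult_right_mono) auto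
    finally show "(\<Sum>e\<in>{e\<in>I. R e k}. c e k * u k) \<le> real k * (C k * u k)" .
  qed
  finally show ?thesis .
qed

text \<open>\<open>E i\<close> is the law of the list read at point \<open>i\<close>, and
  \<open>X i\<close> its jump length. The union bound and \<open>prob_jump\<close> would only give
  \<open>1 - x\<close> in place of \<open>exp (- x)\<close> in \<open>prob_short\<close>; the
  exponential form lets survival probabilities multiply.\<close>

locale jumps =
  fixes E :: "nat \<Rightarrow> 'a pmf" and X :: "nat \<Rightarrow> 'a \<Rightarrow> nat" and M :: nat and u :: "nat \<Rightarrow> real"
  assumes finite_E: "\<And>i. finite (set_pmf (E i))"
    and u_nonneg: "\<And>k. 0 \<le> u k"
    and jump_le: "\<And>i x. x \<in> set_pmf (E i) \<Longrightarrow> X i x \<le> M"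
    and prob_jump: "\<And>i k. 1 \<le> k \<Longrightarrow> measure_pmf.prob (E i) {x. X i x = k} \<le> u k"
    and prob_short: "\<And>i d. exp (- (\<Sum>k\<in>{d<..M}. u k)) \<le> measure_pmf.prob (E i) {x. X i x \<le> d}"
begin

definition U1 :: real where "U1 = (\<Sum>k=1..M. real k * u k)"
definition U2 :: real where "U2 = (\<Sum>k=1..M. (real k)\<^sup>2 * u k)"

lemma U2_nonneg: "0 \<le> U2"
  unfolding U2_def by (intro sum_nonneg) (simp add: u_nonneg)

text \<open>\<open>s\<close> bounds the expected direct extension still ahead, and
  \<open>1 - exp (- t)\<close> the chance of being extended at all, after which the full cost
  \<open>B = U2 * exp U1\<close> is charged for what follows. This \<open>B\<close> solves
  \<open>B = U2 + (1 - exp (- U1)) * B\<close>, that is, \<open>pot U2 U1 = B\<close>.\<close>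

definition pot :: "real \<Rightarrow> real \<Rightarrow> real" where
  "pot s t = s + (1 - exp (- t)) * (U2 * exp U1)"

lemma pot_le: "s \<le> U2 \<Longrightarrow> t \<le> U1 \<Longrightarrow> pot s t \<le> U2 * exp U1"
proof -
  assume st: "s \<le> U2" "t \<le> U1"
  have "exp (- U1) * (U2 * exp U1) \<le> exp (- t) * (U2 * exp U1)"
    using st U2_nonneg by (intro mult_right_mono) auto
  moreover have "exp (- U1) * (U2 * exp U1) = U2" by (simp add: exp_minus field_simps)
  ultimately show ?thesis using st(1) unfolding pot_def left_diff_distrib by linarith
qed

lemma pot_nonneg: "0 \<le> s \<Longrightarrow> 0 \<le> t \<Longrightarrow> 0 \<le> pot s t"
  using U2_nonneg by (auto simp: pot_def)

text \<open>With weight \<open>exp (- t')\<close> the scan goes on undisturbed, otherwise the full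
  cost is charged; the survival factors multiply.\<close>

lemma pot_mix:
  assumes "0 \<le> s" "0 \<le> t'"
  shows "exp (- t') * pot s t + (1 - exp (- t')) * (U2 * exp U1) \<le> pot s (t' + t)"
proof -
  have "exp (- t') * s \<le> 1 * s" using assms by (intro mult_right_mono) auto
  moreover have "exp (- (t' + t)) = exp (- t') * exp (- t)" by (simp add: exp_add[symmetric])
  ultimately show ?thesis unfolding pot_def by (simp add: algebra_simps)
qed

text \<open>\<open>d\<close> counts the unscanned points up to the current end. A point with
  \<open>e\<close> further ones behind it moves the end by \<open>k - e\<close> if its jump is
  \<open>k > e\<close>. The factor \<open>1\<close> keeps the shape of
  \<open>double_sum_weights_le\<close>.\<close>

definition rpot :: "nat \<Rightarrow> real" where
  "rpot d = pot (\<Sum>e<d. \<Sum>k\<in>{k\<in>{1..M}. e < k}. (real k - real e) * u k)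
     (\<Sum>e<d. \<Sum>k\<in>{k\<in>{1..M}. e < k}. 1 * u k)"

text \<open>\<open>g\<close> is the distance from the leftmost absorbed point to the next scanned
  one. A point at distance \<open>e\<close> is absorbed by any jump of length at least
  \<open>e\<close>, and the end then moves by \<open>e\<close> whatever the length.\<close>

definition lpot :: "nat \<Rightarrow> real" where
  "lpot g = pot (\<Sum>e=g..M. \<Sum>k\<in>{k\<in>{1..M}. e \<le> k}. real e * u k)
     (\<Sum>e=g..M. \<Sum>k\<in>{k\<in>{1..M}. e \<le> k}. 1 * u k)"

lemma rpot_le: "rpot d \<le> U2 * exp U1"
proof -
  have card: "card {e \<in> {..<d}. e < k} \<le> k" for k
    using card_mono[of "{..<k}" "{e \<in> {..<d}. e < k}"] by auto
  show ?thesis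
    unfolding rpot_def
  proof (rule pot_le)
    show "(\<Sum>e\<in>{..<d}. \<Sum>k\<in>{k\<in>{1..M}. e < k}. (real k - real e) * u k) \<le> U2"
      using double_sum_weights_le[of "{..<d}" u "\<lambda>e k. e < k" "\<lambda>e k. (real k - real e)" real M]
        card u_nonneg by (simp add: U2_def power2_eq_square mult.assoc)
    show "(\<Sum>e\<in>{..<d}. \<Sum>k\<in>{k\<in>{1..M}. e < k}. 1 * u k) \<le> U1"
      using double_sum_weights_le[of "{..<d}" u "\<lambda>e k. e < k" "\<lambda>_ _. 1" "\<lambda>_. 1" M]
        card u_nonneg by (simp add: U1_def)
  qed
qed

text \<open>Distances start at 1, so at most \<open>k\<close> of them are bounded by
  \<open>k\<close>.\<close>

lemma lpot_le:
  assumes "1 \<le> g"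
  shows "lpot g \<le> U2 * exp U1"
proof -
  have card: "card {e \<in> {g..M}. e \<le> k} \<le> k" for k
  proof -
    have "card {e \<in> {g..M}. e \<le> k} \<le> card {1..k}" using assms by (intro card_mono) auto
    then show ?thesis by simp
  qed
  show ?thesis
    unfolding lpot_def
  proof (rule pot_le)
    show "(\<Sum>e\<in>{g..M}. \<Sum>k\<in>{k\<in>{1..M}. e \<le> k}. real e * u k) \<le> U2"
      using double_sum_weights_le[of "{g..M}" u "\<lambda>e k. e \<le> k" "\<lambda>e k. real e" real M]
        card u_nonneg by (simp add: U2_def power2_eq_square mult.assoc)
    show "(\<Sum>e\<in>{g..M}. \<Sum>k\<in>{k\<in>{1..M}. e \<le> k}. 1 * u k) \<le> U1"
      using double_sum_weights_le[of "{g..M}" u "\<lambda>e k. e \<le> k" "\<lambda>_ _. 1" "\<lambda>_. 1" M]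
        card u_nonneg by (simp add: U1_def)
  qed
qed

lemma rpot_nonneg: "0 \<le> rpot d"
  unfolding rpot_def by (intro pot_nonneg sum_nonneg) (auto simp: u_nonneg)

lemma lpot_nonneg: "0 \<le> lpot d"
  unfolding lpot_def by (intro pot_nonneg sum_nonneg) (auto simp: u_nonneg)

lemma prob_long_le:
  "measure_pmf.prob (E i) {x. d < X i x} \<le> 1 - exp (- (\<Sum>k\<in>{d<..M}. u k))"
proof -
  have "{x. d < X i x} = UNIV - {x. X i x \<le> d}" by auto
  then show ?thesis
    using prob_short[of d i] measure_pmf.prob_compl[of "{x. X i x \<le> d}" "E i"] by simp
qed

text \<open>One list is revealed. The direct extension is bounded through the point probabilities of
  the jump, the charge for a fresh start through the probability of a jump beyond
  \<open>e\<close>.\<close>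

lemma expectation_right_step:
  fixes F :: "'a \<Rightarrow> real"
  assumes "\<And>x. X i x \<le> e \<Longrightarrow> F x \<le> rpot e"
    and "\<And>x. e < X i x \<Longrightarrow> F x \<le> real (X i x) - real e + U2 * exp U1"
  shows "measure_pmf.expectation (E i) F \<le> rpot (Suc e)"
proof -
  let ?K = "{k\<in>{1..M}. e < k}" and ?B = "U2 * exp U1"
  let ?t = "\<Sum>k\<in>?K. 1 * u k"
  have K: "?K = {e<..M}" by auto
  have "measure_pmf.expectation (E i) F \<le> measure_pmf.expectation (E i) (\<lambda>x. rpot e +
      (\<Sum>k\<in>?K. (real k - real e) * indicator {x. X i x = k} x) +
      (?B - rpot e) * indicator {x. e < X i x} x)"
  proof (rule expectation_mono_finite[OF finite_E])
    fix x assume x: "x \<in> set_pmf (E i)"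
    \<comment> \<open>At most the term \<open>k = X i x\<close> survives; \<open>jump_le\<close>
      keeps it in range.\<close>
    have "(\<Sum>k\<in>?K. (real k - real e) * indicator {x. X i x = k} x) =
        (if e < X i x then real (X i x) - real e else 0)"
    proof (cases "e < X i x")
      case True
      then have "X i x \<in> ?K" using jump_le[OF x] by auto
      then have "(\<Sum>k\<in>?K. (real k - real e) * indicator {x. X i x = k} x) =
          (\<Sum>k\<in>{X i x}. (real k - real e) * indicator {x. X i x = k} x)"
        by (intro sum.mono_neutral_right) auto
      then show ?thesis using True by simp
    next
      case False
      then show ?thesis by (auto intro!: sum.neutral)
    qed
    then show "F x \<le> rpot e + (\<Sum>k\<in>?K. (real k - real e) * indicator {x. X i x = k} x) +
        (?B - rpot e) * indicator {x. e < X i x} x"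
      using assms(1)[of x] assms(2)[of x] by (cases "e < X i x") auto
  qed
  also have "\<dots> = rpot e + (\<Sum>k\<in>?K. (real k - real e) * measure_pmf.prob (E i) {x. X i x = k}) +
      (?B - rpot e) * measure_pmf.prob (E i) {x. e < X i x}"
    by (simp add: integrable_measure_pmf_finite[OF finite_E] del: sum_mult_indicator)
  \<comment> \<open>\<open>rpot_le\<close> makes the coefficient \<open>?B - rpot e\<close>
    nonnegative.\<close>
  also have "\<dots> \<le> rpot e + (\<Sum>k\<in>?K. (real k - real e) * u k) + (?B - rpot e) * (1 - exp (- ?t))"
    using rpot_le[of e] prob_long_le[of i e] unfolding K
    by (intro add_mono mult_left_mono sum_mono prob_jump) auto
  also have "\<dots> = (\<Sum>k\<in>?K. (real k - real e) * u k) +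
      (exp (- ?t) * rpot e + (1 - exp (- ?t)) * ?B)"
    by (simp add: algebra_simps)
  \<comment> \<open>In the sums over \<open>e<e\<close> the bound variable shadows the fixed
    \<open>e\<close>, which is the upper limit.\<close>
  also have "\<dots> \<le> (\<Sum>k\<in>?K. (real k - real e) * u k) +
      pot (\<Sum>e<e. \<Sum>k\<in>{k\<in>{1..M}. e < k}. (real k - real e) * u k)
        (?t + (\<Sum>e<e. \<Sum>k\<in>{k\<in>{1..M}. e < k}. 1 * u k))"
    unfolding rpot_def by (intro add_left_mono pot_mix sum_nonneg) (auto simp: u_nonneg)
  also have "\<dots> = rpot (Suc e)"
    by (simp add: rpot_def pot_def algebra_simps)
  finally show ?thesis .
qed

text \<open>Here only the event of a jump of length at least \<open>g\<close> matters. Its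
  probability is at most \<open>1 - exp (- ?t)\<close> for the fresh start, and hence at most
  \<open>?t\<close> for the extension.\<close>

lemma expectation_left_step:
  fixes F :: "'a \<Rightarrow> real"
  assumes g: "1 \<le> g" and "\<And>x. X i x < g \<Longrightarrow> F x \<le> lpot (Suc g)"
    and "\<And>x. g \<le> X i x \<Longrightarrow> F x \<le> real g + U2 * exp U1"
  shows "measure_pmf.expectation (E i) F \<le> lpot g"
proof -
  let ?K = "{k\<in>{1..M}. g \<le> k}" and ?B = "U2 * exp U1"
  let ?t = "\<Sum>k\<in>?K. 1 * u k" and ?p = "measure_pmf.prob (E i) {x. g \<le> X i x}"
  let ?s' = "\<Sum>e=Suc g..M. \<Sum>k\<in>{k\<in>{1..M}. e \<le> k}. real e * u k"
  let ?t' = "\<Sum>e=Suc g..M. \<Sum>k\<in>{k\<in>{1..M}. e \<le> k}. 1 * u k"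
  have t: "0 \<le> ?t" by (intro sum_nonneg) (simp add: u_nonneg)
  \<comment> \<open>\<open>prob_long_le\<close> is about strict excess, hence
    \<open>g - 1\<close>.\<close>
  have "{g - 1<..M} = ?K" "{x. g - 1 < X i x} = {x. g \<le> X i x}" using g by auto
  then have p: "?p \<le> 1 - exp (- ?t)" using prob_long_le[of i "g - 1"] by simp
  then have p': "?p \<le> ?t" using exp_ge_add_one_self[of "- ?t"] by linarith
  have "measure_pmf.expectation (E i) F \<le> measure_pmf.expectation (E i) (\<lambda>x. lpot (Suc g) +
      real g * indicator {x. g \<le> X i x} x + (?B - lpot (Suc g)) * indicator {x. g \<le> X i x} x)"
  proof (rule expectation_mono_finite[OF finite_E])
    fix x
    show "F x \<le> lpot (Suc g) + real g * indicator {x. g \<le> X i x} x +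
        (?B - lpot (Suc g)) * indicator {x. g \<le> X i x} x"
      using assms(2)[of x] assms(3)[of x] by (cases "g \<le> X i x") auto
  qed
  also have "\<dots> = lpot (Suc g) + real g * ?p + (?B - lpot (Suc g)) * ?p"
    by (simp add: integrable_measure_pmf_finite[OF finite_E])
  also have "\<dots> \<le> lpot (Suc g) + real g * ?t + (?B - lpot (Suc g)) * (1 - exp (- ?t))"
    using lpot_le[of "Suc g"] p p' by (intro add_mono mult_left_mono) auto
  also have "\<dots> = real g * ?t + (exp (- ?t) * lpot (Suc g) + (1 - exp (- ?t)) * ?B)"
    by (simp add: algebra_simps)
  also have "\<dots> \<le> real g * ?t + pot ?s' (?t + ?t')"
    unfolding lpot_def using t by (intro add_left_mono pot_mix sum_nonneg) (auto simp: u_nonneg)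
  also have "\<dots> = lpot g"
  proof (cases "g \<le> M")
    case True
    then have "{g..M} = insert g {Suc g..M}" by auto
    then show ?thesis by (simp add: lpot_def pot_def sum_distrib_left algebra_simps)
  next
    case False
    then have "?K = {}" by auto
    then have "?t = 0" by (metis sum.empty)
    moreover have "{g..M} = {}" "{Suc g..M} = {}" using False by auto
    ultimately show ?thesis by (simp add: lpot_def)
  qed
  finally show ?thesis .
qed

text \<open>The list at \<open>Suc a\<close> is revealed first; by independence the induction
  hypothesis bounds the rest of the scan for each of its values.\<close>

lemma expectation_right_end:
  "measure_pmf.expectation (Pi_pmf {a<..a + k} d E)
     (\<lambda>Q. real (right_end (\<lambda>i. X i (Q i)) a b k - b)) \<le> rpot (b - a)"
proof (induction k arbitrary: a b)
  case 0
  then show ?case by (simp add: rpot_nonneg)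
next
  case (Suc k)
  show ?case
  proof (cases "a < b")
    case False
    then show ?thesis by (simp add: right_end_stop rpot_nonneg del: right_end.simps)
  next
    case True
    let ?P = "Pi_pmf {Suc a<..Suc a + k} d E"
    \<comment> \<open>\<open>e\<close> points remain below the end after \<open>Suc a\<close>, and
      \<open>F x\<close> is the expected extension given the list \<open>x\<close> at
      \<open>Suc a\<close>.\<close>
    define e where "e = b - Suc a"
    define H where "H = (\<lambda>Q. real (right_end (\<lambda>i. X i (Q i)) a b (Suc k) - b))"
    define F where "F = (\<lambda>x. measure_pmf.expectation ?P (\<lambda>Q. H (Q(Suc a := x))))"
    have fin: "finite (set_pmf ?P)" by (intro finite_set_Pi_pmf) (auto simp: finite_E)
    have F: "F x \<le> real (b' - b) + rpot (b' - Suc a)" if b': "b' = max b (Suc a + X (Suc a) x)" for x b'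
    proof -
      have "right_end (\<lambda>i. X i ((Q(Suc a := x)) i)) a b (Suc k) =
          right_end (\<lambda>i. X i ((Q(Suc a := x)) i)) (Suc a) b' k" for Q
        using True by (simp add: b')
      also have "right_end (\<lambda>i. X i ((Q(Suc a := x)) i)) (Suc a) b' k =
          right_end (\<lambda>i. X i (Q i)) (Suc a) b' k" for Q
        by (rule right_end_cong) auto
      finally have "F x = measure_pmf.expectation ?P
          (\<lambda>Q. real (right_end (\<lambda>i. X i (Q i)) (Suc a) b' k - b))"
        by (simp only: F_def H_def)
      also have "\<dots> = measure_pmf.expectation ?P
          (\<lambda>Q. real (b' - b) + real (right_end (\<lambda>i. X i (Q i)) (Suc a) b' k - b'))"
      proof (rule Bochner_Integration.integral_cong)
        fix Q :: "nat \<Rightarrow> 'a"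
        \<comment> \<open>These bounds make the truncated subtractions additive.\<close>
        have "b \<le> b'" "b' \<le> right_end (\<lambda>i. X i (Q i)) (Suc a) b' k"
          using b' right_end_ge by auto
        then show "real (right_end (\<lambda>i. X i (Q i)) (Suc a) b' k - b) =
            real (b' - b) + real (right_end (\<lambda>i. X i (Q i)) (Suc a) b' k - b')"
          by linarith
      qed simp
      also have "\<dots> \<le> real (b' - b) + rpot (b' - Suc a)"
        using Suc.IH[of "Suc a" b'] by (simp add: integrable_measure_pmf_finite[OF fin] del: add_Suc)
      finally show ?thesis .
    qed
    have "{a<..a + Suc k} = insert (Suc a) {Suc a<..Suc a + k}" by auto
    then have "measure_pmf.expectation (Pi_pmf {a<..a + Suc k} d E) H =
        measure_pmf.expectation (E (Suc a)) F"
      using expectation_Pi_pmf_insert(1)[of "{Suc a<..Suc a + k}" "Suc a" E d H]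
      by (simp add: F_def finite_E)
    also have "\<dots> \<le> rpot (Suc e)"
    proof (rule expectation_right_step)
      fix x assume "X (Suc a) x \<le> e"
      then have "b = max b (Suc a + X (Suc a) x)" using True by (simp add: e_def)
      then show "F x \<le> rpot e" using F[of b x] by (simp add: e_def)
    next
      fix x assume "e < X (Suc a) x"
      then have "Suc a + X (Suc a) x = max b (Suc a + X (Suc a) x)"
        and "real (Suc a + X (Suc a) x - b) = real (X (Suc a) x) - real e"
        using True by (auto simp: e_def)
      then show "F x \<le> real (X (Suc a) x) - real e + U2 * exp U1"
        using F[of "Suc a + X (Suc a) x" x] rpot_le by (metis add_left_mono order_trans)
    qed
    finally show ?thesis using True by (simp add: e_def H_def Suc_diff_Suc del: right_end.simps)
  qed
qed

text \<open>The same induction downwards: the largest index is revealed first, and an absorbed point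
  becomes the new left end at distance 1 from the next one.\<close>

lemma expectation_left_end:
  "i < a \<Longrightarrow> measure_pmf.expectation (Pi_pmf {1..i} d E)
     (\<lambda>Q. real (a - left_end (\<lambda>i. X i (Q i)) a i)) \<le> lpot (a - i)"
proof (induction i arbitrary: a)
  case 0
  then show ?case by (simp add: lpot_nonneg)
next
  case (Suc i)
  let ?P = "Pi_pmf {1..i} d E"
  define g where "g = a - Suc i"
  have g: "1 \<le> g" using Suc.prems by (simp add: g_def)
  define H where "H = (\<lambda>Q. real (a - left_end (\<lambda>i. X i (Q i)) a (Suc i)))"
  define F where "F = (\<lambda>x. measure_pmf.expectation ?P (\<lambda>Q. H (Q(Suc i := x))))"
  have fin: "finite (set_pmf ?P)" by (intro finite_set_Pi_pmf) (auto simp: finite_E)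
  have upd: "left_end (\<lambda>j. X j ((Q(Suc i := x)) j)) a' i = left_end (\<lambda>j. X j (Q j)) a' i" for Q x a'
    by (rule left_end_cong) auto
  have "{1..Suc i} = insert (Suc i) {1..i}" by auto
  then have "measure_pmf.expectation (Pi_pmf {1..Suc i} d E) H = measure_pmf.expectation (E (Suc i)) F"
    using expectation_Pi_pmf_insert(1)[of "{1..i}" "Suc i" E d H] by (simp add: F_def finite_E)
  also have "\<dots> \<le> lpot g"
  proof (rule expectation_left_step[OF g])
    fix x assume "X (Suc i) x < g"
    then have "\<not> a \<le> Suc i + X (Suc i) x" by (simp add: g_def)
    then have "left_end (\<lambda>j. X j ((Q(Suc i := x)) j)) a (Suc i) = left_end (\<lambda>j. X j (Q j)) a i" for Q
      using upd[of Q x a] by simp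
    then have "F x = measure_pmf.expectation ?P (\<lambda>Q. real (a - left_end (\<lambda>j. X j (Q j)) a i))"
      by (simp only: F_def H_def)
    also have "\<dots> \<le> lpot (a - i)" using Suc by simp
    finally show "F x \<le> lpot (Suc g)" using Suc.prems by (simp add: g_def Suc_diff_Suc)
  next
    fix x assume "g \<le> X (Suc i) x"
    then have "a \<le> Suc i + X (Suc i) x" by (simp add: g_def)
    then have "left_end (\<lambda>j. X j ((Q(Suc i := x)) j)) a (Suc i) =
        left_end (\<lambda>j. X j (Q j)) (Suc i) i" for Q
      using upd[of Q x "Suc i"] by simp
    then have "F x = measure_pmf.expectation ?P (\<lambda>Q. real (a - left_end (\<lambda>j. X j (Q j)) (Suc i) i))"
      by (simp only: F_def H_def)
    also have "\<dots> = measure_pmf.expectation ?P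
        (\<lambda>Q. real g + real (Suc i - left_end (\<lambda>j. X j (Q j)) (Suc i) i))"
    proof -
      have le: "left_end Y (Suc i) i \<le> Suc i" for Y using left_end_le[of i "Suc i" Y] by auto
      have "real (a - left_end Y (Suc i) i) = real g + real (Suc i - left_end Y (Suc i) i)" for Y
        using Suc.prems le[of Y] unfolding g_def by linarith
      then show ?thesis by simp
    qed
    also have "\<dots> \<le> real g + lpot (Suc i - i)"
      using Suc.IH[of "Suc i"]
      by (subst Bochner_Integration.integral_add) (auto intro: integrable_measure_pmf_finite[OF fin[simplified]])
    also have "\<dots> \<le> real g + U2 * exp U1" using lpot_le[of "Suc i - i"] by simp
    finally show "F x \<le> real g + U2 * exp U1" .
  qed
  finally show ?case by (simp add: g_def H_def del: left_end.simps)
qed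

end

section \<open>Man-optimal stable matchings\<close>

lemma ex_top:
  assumes "finite S" "S \<noteq> {}" "trans r" "irrefl r" "total_on S r"
  shows "\<exists>a\<in>S. \<forall>b\<in>S. b \<noteq> a \<longrightarrow> (a, b) \<in> r"
proof -
  obtain xs where xs: "set xs = S" "sorted_wrt (\<lambda>x y. (x, y) \<in> r) xs"
    using ex_sorted_wrt_strict_linear_order[OF assms(1,3,4,5)] by metis
  then obtain a ys where "xs = a # ys" using assms(2) by (cases xs) auto
  then show ?thesis using xs by (intro bexI[of _ a]) auto
qed

definition proposers ::
    "nat \<Rightarrow> (person \<Rightarrow> person rel) \<Rightarrow> (person \<Rightarrow> person) \<Rightarrow> person \<Rightarrow> person set" where
  "proposers M R \<mu> w =
     {m \<in> men M. (m, w) \<in> R w \<and> (\<mu> m = w \<or> (w, \<mu> m) \<in> R m)}"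

text \<open>Fixing the value outside the participants makes \<open>\<mu>\<close> unique as a
  function, so that it can label conditioning classes.\<close>

definition man_optimal ::
    "nat \<Rightarrow> nat \<Rightarrow> (person \<Rightarrow> person rel) \<Rightarrow> (person \<Rightarrow> person) \<Rightarrow> bool" where
  "man_optimal M W R \<mu> \<longleftrightarrow> stable M W R \<mu> \<and>
     (\<forall>p. p \<notin> men M \<union> women W \<longrightarrow> \<mu> p = p) \<and>
     (\<forall>\<nu> m. stable M W R \<nu> \<longrightarrow> m \<in> men M \<longrightarrow> \<mu> m = \<nu> m \<or> (\<mu> m, \<nu> m) \<in> R m)"

lemma men_women_disjoint: "m \<in> men M \<Longrightarrow> m \<notin> women W" "w \<in> women W \<Longrightarrow> w \<notin> men M"
  by (auto simp: men_def women_def)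

lemma opposite_men [simp]: "m \<in> men M \<Longrightarrow> opposite M W m = women W"
  by (auto simp: men_def)

lemma opposite_women [simp]: "w \<in> women W \<Longrightarrow> opposite M W w = men M"
  by (auto simp: women_def)

lemma finite_men [simp]: "finite (men M)" by (simp add: men_def)
lemma finite_women [simp]: "finite (women W)" by (simp add: women_def)

locale market =
  fixes M W :: nat and R :: "person \<Rightarrow> person rel"
  assumes prefs: "\<And>p. p \<in> men M \<union> women W \<Longrightarrow> pref_order M W p (R p)"
begin

abbreviation "persons \<equiv> men M \<union> women W"

lemma trans_R: "p \<in> persons \<Longrightarrow> trans (R p)"
  and irrefl_R: "p \<in> persons \<Longrightarrow> irrefl (R p)"
  and total_R: "p \<in> persons \<Longrightarrow> total_on (insert p (opposite M W p)) (R p)"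
  and dom_R: "p \<in> persons \<Longrightarrow> R p \<subseteq> insert p (opposite M W p) \<times> insert p (opposite M W p)"
  using prefs by (auto simp: pref_order_def strict_linear_order_on_def)

lemma R_trans: "p \<in> persons \<Longrightarrow> (a, b) \<in> R p \<Longrightarrow> (b, c) \<in> R p \<Longrightarrow> (a, c) \<in> R p"
  using trans_R by (meson transD)

lemma R_asym: "p \<in> persons \<Longrightarrow> (a, b) \<in> R p \<Longrightarrow> (b, a) \<notin> R p"
  using trans_R irrefl_R by (meson irrefl_def transD)

lemma R_irrefl: "p \<in> persons \<Longrightarrow> (a, a) \<notin> R p"
  using R_asym by blast

lemma R_total:
  "p \<in> persons \<Longrightarrow> a \<in> insert p (opposite M W p) \<Longrightarrow> b \<in> insert p (opposite M W p) \<Longrightarrow>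
    a \<noteq> b \<Longrightarrow> (a, b) \<notin> R p \<Longrightarrow> (b, a) \<in> R p"
  using total_R unfolding total_on_def by blast

lemma stable_range: "stable M W R \<nu> \<Longrightarrow> p \<in> persons \<Longrightarrow> \<nu> p \<in> insert p (opposite M W p)"
  and stable_invol: "stable M W R \<nu> \<Longrightarrow> p \<in> persons \<Longrightarrow> \<nu> (\<nu> p) = p"
  and stable_acceptable: "stable M W R \<nu> \<Longrightarrow> p \<in> persons \<Longrightarrow> \<nu> p \<noteq> p \<Longrightarrow> (\<nu> p, p) \<in> R p"
  by (auto simp: stable_def matching_def person_blocks_def acceptable_def)

lemma stable_man: "stable M W R \<nu> \<Longrightarrow> m \<in> men M \<Longrightarrow> \<nu> m \<noteq> m \<Longrightarrow> \<nu> m \<in> women W"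
  using stable_range[of \<nu> m] by auto

lemma stable_woman: "stable M W R \<nu> \<Longrightarrow> w \<in> women W \<Longrightarrow> \<nu> w \<noteq> w \<Longrightarrow> \<nu> w \<in> men M"
  using stable_range[of \<nu> w] by auto

text \<open>Equality \<open>\<nu> w = m\<close> is excluded because \<open>m\<close> would then
  prefer \<open>w\<close> to \<open>w\<close> itself.\<close>

lemma stable_no_block:
  assumes "stable M W R \<nu>" "m \<in> men M" "w \<in> women W" "(w, \<nu> m) \<in> R m"
  shows "(\<nu> w, m) \<in> R w"
proof -
  have "(m, \<nu> w) \<notin> R w" using assms by (auto simp: stable_def pair_blocks_def)
  moreover have "\<nu> w \<noteq> m"
    using assms stable_invol[of \<nu> w] R_irrefl[of m w] by auto
  ultimately show ?thesis using R_total[of w m "\<nu> w"] stable_range[of \<nu> w] assms by auto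
qed

lemma woman_weakly_prefers:
  assumes "stable M W R \<nu>" "m \<in> men M" "w \<in> women W" "(m, w) \<in> R w"
    and "w = \<nu> m \<or> (w, \<nu> m) \<in> R m"
  shows "\<nu> w = m \<or> (\<nu> w, m) \<in> R w" and "\<nu> w \<noteq> w"
proof -
  show *: "\<nu> w = m \<or> (\<nu> w, m) \<in> R w"
    using assms stable_no_block stable_invol[of \<nu> m] by auto
  have "m \<noteq> w" using assms men_women_disjoint by blast
  then show "\<nu> w \<noteq> w" using * assms(3,4) R_asym by auto
qed

text \<open>Every man receives his best partner over all stable matchings. In the application
  \<open>\<nu>0\<close> comes from the event that the given woman has a stable partner. The second
  conclusion, part of the rural hospitals theorem, then supplies her partner in
  \<open>\<mu>\<close>.\<close>

lemma ex_man_optimal: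
  assumes "stable M W R \<nu>0"
  shows "\<exists>\<mu>. man_optimal M W R \<mu> \<and>
    (\<forall>\<nu> w. stable M W R \<nu> \<longrightarrow> w \<in> women W \<longrightarrow> \<nu> w \<noteq> w \<longrightarrow> \<mu> w \<noteq> w)"
proof -
  have "\<exists>\<nu>. stable M W R \<nu> \<and> (\<forall>\<nu>'. stable M W R \<nu>' \<longrightarrow> \<nu> m = \<nu>' m \<or> (\<nu> m, \<nu>' m) \<in> R m)"
    if m: "m \<in> men M" for m
  proof -
    let ?S = "(\<lambda>\<nu>. \<nu> m) ` {\<nu>. stable M W R \<nu>}"
    have sub: "?S \<subseteq> insert m (women W)" using stable_range[of _ m] m by auto
    have "\<exists>a\<in>?S. \<forall>b\<in>?S. b \<noteq> a \<longrightarrow> (a, b) \<in> R m"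
    proof (rule ex_top)
      show "finite ?S" using sub by (rule finite_subset) simp
      show "total_on ?S (R m)" using total_on_subset[OF total_R[of m]] sub m by auto
    qed (use assms m trans_R irrefl_R in auto)
    then show ?thesis by auto metis
  qed
  then obtain N where N: "\<And>m. m \<in> men M \<Longrightarrow> stable M W R (N m)"
    and top: "\<And>m \<nu>. m \<in> men M \<Longrightarrow> stable M W R \<nu> \<Longrightarrow> N m m = \<nu> m \<or> (N m m, \<nu> m) \<in> R m"
    by metis
  define best where "best = (\<lambda>m. N m m)"
  have best_range: "best m \<in> insert m (women W)" if "m \<in> men M" for m
    using stable_range[OF N[OF that], of m] that by (simp add: best_def)
  have best_partner: "N m (best m) = m" if "m \<in> men M" for m
    using stable_invol[OF N[OF that], of m] that by (simp add: best_def)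
  have best_acc: "(m, w) \<in> R w" if "m \<in> men M" "best m = w" "w \<in> women W" for m w
    using stable_acceptable[OF N[OF that(1)], of w] best_partner[OF that(1)] that men_women_disjoint
    by fastforce
  have weak: "\<nu> w = m \<or> (\<nu> w, m) \<in> R w" "\<nu> w \<noteq> w"
    if "m \<in> men M" "best m = w" "w \<in> women W" "stable M W R \<nu>" for m w \<nu>
    using woman_weakly_prefers[OF that(4,1,3) best_acc[OF that(1-3)]] top[OF that(1,4)] that(2)
    by (auto simp: best_def)
  \<comment> \<open>By \<open>weak\<close>, in every stable matching \<open>w\<close> does at least
    as well as with any man whose best partner she is. In \<open>N m\<close> and \<open>N m'\<close>
    this ranks each of the two men above the other.\<close>
  have inj: "m = m'" if "m \<in> men M" "m' \<in> men M" "best m = w" "best m' = w" "w \<in> women W" for m m' w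
  proof (rule ccontr)
    assume "m \<noteq> m'"
    moreover have "N m w = m" "N m' w = m'"
      using best_partner[OF that(1)] best_partner[OF that(2)] that(3,4) by auto
    ultimately have "(m', m) \<in> R w" "(m, m') \<in> R w"
      using weak(1)[OF that(1,3,5) N[OF that(2)]] weak(1)[OF that(2,4,5) N[OF that(1)]] by auto
    then show False using R_asym that(5) by blast
  qed
  \<comment> \<open>Counting: \<open>best\<close> injects the men with a best partner into the women
    matched by \<open>\<nu>\<close>, and \<open>\<nu>\<close> injects these women back, so
    \<open>best\<close> reaches all of them.\<close>
  have matched: "\<exists>m\<in>men M. best m = w" if "stable M W R \<nu>" "w \<in> women W" "\<nu> w \<noteq> w" for \<nu> w
  proof -
    let ?MM = "{m \<in> men M. best m \<noteq> m}" and ?WM = "{w \<in> women W. \<nu> w \<noteq> w}"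
    have sub: "best ` ?MM \<subseteq> ?WM" using best_range weak(2)[OF _ refl _ that(1)] by fastforce
    have "\<nu> ` ?WM \<subseteq> ?MM"
    proof
      fix m assume "m \<in> \<nu> ` ?WM"
      then obtain w where w: "w \<in> women W" "\<nu> w \<noteq> w" "m = \<nu> w" by auto
      then have m: "m \<in> men M" using stable_woman[OF that(1)] by blast
      have "\<nu> m = w" using stable_invol[OF that(1), of w] w by simp
      then have acc: "(w, m) \<in> R m" "m \<noteq> w"
        using stable_acceptable[OF that(1), of m] w m by auto
      then have "best m \<noteq> m"
        using top[OF m that(1)] R_asym[of m w m] m \<open>\<nu> m = w\<close> by (auto simp: best_def)
      then show "m \<in> ?MM" using m by simp
    qed
    moreover have "inj_on \<nu> ?WM"
      by (rule inj_on_inverseI[of _ \<nu>]) (simp add: stable_invol[OF that(1)])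
    ultimately have "card ?WM \<le> card ?MM" by (intro card_inj_on_le[of \<nu>]) auto
    also have "card ?MM = card (best ` ?MM)"
      using best_range by (intro card_image[symmetric] inj_onI) (metis (mono_tags, lifting) inj insertE mem_Collect_eq)
    finally have "best ` ?MM = ?WM" using sub by (intro card_seteq) auto
    then have "w \<in> best ` ?MM" using that(2,3) by simp
    then show ?thesis by blast
  qed
  \<comment> \<open>On women \<open>\<mu>\<close> inverts \<open>best\<close>; \<open>inj\<close>
    makes the description unique.\<close>
  define \<mu> where "\<mu> = (\<lambda>p. if p \<in> men M then best p
    else if \<exists>m\<in>men M. best m = p \<and> p \<in> women W then THE m. m \<in> men M \<and> best m = p else p)"
  have \<mu>m: "\<mu> m = best m" if "m \<in> men M" for m using that by (simp add: \<mu>_def)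
  have \<mu>w: "\<mu> w = m" if "m \<in> men M" "best m = w" "w \<in> women W" for m w
  proof -
    have "(THE m. m \<in> men M \<and> best m = w) = m" using inj that by (intro the_equality) auto
    then show ?thesis using that men_women_disjoint by (auto simp: \<mu>_def)
  qed
  have \<mu>w': "\<mu> w = w" if "w \<in> women W" "\<not> (\<exists>m\<in>men M. best m = w)" for w
    using that men_women_disjoint by (auto simp: \<mu>_def)
  have "matching M W \<mu>"
    unfolding matching_def
  proof
    fix p assume "p \<in> persons"
    then consider "p \<in> men M" | m where "p \<in> women W" "m \<in> men M" "best m = p"
      | "p \<in> women W" "\<not> (\<exists>m\<in>men M. best m = p)" by blast
    then show "\<mu> p \<in> insert p (opposite M W p) \<and> \<mu> (\<mu> p) = p"
    proof cases
      case 1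
      then show ?thesis
        using best_range[OF 1] \<mu>w[OF 1 refl] by (cases "best p = p") (auto simp: \<mu>m)
    next
      case 2
      then show ?thesis by (simp add: \<mu>w \<mu>m)
    next
      case 3
      then show ?thesis by (simp add: \<mu>w')
    qed
  qed
  moreover have "\<not> pair_blocks R \<mu> m w" if "m \<in> men M" "w \<in> women W" for m w
  proof
    assume "pair_blocks R \<mu> m w"
    then have b: "(m, \<mu> w) \<in> R w" "(w, best m) \<in> R m" using \<mu>m that by (auto simp: pair_blocks_def)
    \<comment> \<open>A blocking man prefers \<open>w\<close> to his best partner, so every stable
      matching gives \<open>w\<close> someone better than him. This fails in \<open>N m0\<close> if
      \<open>best m0 = w\<close>, and in \<open>\<nu>0\<close> if \<open>w\<close> is nobody's best
      partner.\<close>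
    have all: "(\<nu> w, m) \<in> R w" if \<nu>: "stable M W R \<nu>" for \<nu>
    proof (rule stable_no_block[OF \<nu> \<open>m \<in> men M\<close> \<open>w \<in> women W\<close>])
      show "(w, \<nu> m) \<in> R m"
        using top[OF \<open>m \<in> men M\<close> \<nu>] b(2) R_trans[of m w "best m" "\<nu> m"] \<open>m \<in> men M\<close>
        by (auto simp: best_def)
    qed
    show False
    proof (cases "\<exists>m0\<in>men M. best m0 = w")
      case True
      then obtain m0 where m0: "m0 \<in> men M" "best m0 = w" by blast
      then have "N m0 w = m0" using best_partner by blast
      then show False
        using all[OF N[OF m0(1)]] b(1) \<mu>w[OF m0 that(2)] R_asym[of w m0 m] that by auto
    next
      case False
      then have "\<nu>0 w = w" using matched[OF assms that(2)] by blast
      then show False using all[OF assms] b(1) \<mu>w'[OF that(2) False] R_asym[of w m w] that by auto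
    qed
  qed
  moreover have "\<not> person_blocks R \<mu> p" if "p \<in> persons" for p
  proof
    assume pb: "person_blocks R \<mu> p"
    show False
    proof (cases "p \<in> men M")
      case True
      then show False using pb stable_acceptable[OF N[OF True], of p]
        by (auto simp: person_blocks_def acceptable_def \<mu>m best_def)
    next
      case False
      then have "p \<in> women W" using that by simp
      then show False using pb \<mu>w \<mu>w' best_acc
        by (auto simp: person_blocks_def acceptable_def) metis
    qed
  qed
  ultimately have "stable M W R \<mu>" by (auto simp: stable_def)
  moreover have "\<mu> p = p" if "p \<notin> persons" for p using that by (auto simp: \<mu>_def)
  ultimately have "man_optimal M W R \<mu>"
    using top by (auto simp: man_optimal_def \<mu>m best_def)
  moreover have "\<mu> w \<noteq> w" if \<nu>: "stable M W R \<nu>" "w \<in> women W" "\<nu> w \<noteq> w" for \<nu> w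
  proof -
    obtain m where m: "m \<in> men M" "best m = w" using matched[OF \<nu>] by blast
    then show ?thesis using \<mu>w[OF m \<nu>(2)] \<nu>(2) men_women_disjoint(1)[of m M W] by metis
  qed
  ultimately show ?thesis by blast
qed

lemma man_optimal_unique:
  assumes "man_optimal M W R \<mu>" "man_optimal M W R \<nu>"
  shows "\<mu> = \<nu>"
proof
  fix p
  have st: "stable M W R \<mu>" "stable M W R \<nu>" using assms by (auto simp: man_optimal_def)
  have men: "\<mu> m = \<nu> m" if m: "m \<in> men M" for m
  proof -
    have "\<mu> m = \<nu> m \<or> (\<mu> m, \<nu> m) \<in> R m" "\<nu> m = \<mu> m \<or> (\<nu> m, \<mu> m) \<in> R m"
      using assms st m by (auto simp: man_optimal_def)
    then show ?thesis using R_asym[of m "\<mu> m" "\<nu> m"] m by auto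
  qed
  consider "p \<in> men M" | "p \<in> women W" | "p \<notin> persons" by blast
  then show "\<mu> p = \<nu> p"
  proof cases
    case 2
    have "\<rho>' p = \<rho> p"
      if r: "stable M W R \<rho>" "stable M W R \<rho>'" "\<And>m. m \<in> men M \<Longrightarrow> \<rho> m = \<rho>' m" "\<rho> p \<noteq> p" for \<rho> \<rho>'
    proof -
      have "\<rho> p \<in> men M" using stable_woman r 2 by blast
      then have "\<rho>' (\<rho> p) = p" using r(3) stable_invol[OF r(1), of p] 2 by simp
      then show ?thesis using stable_invol[OF r(2), of "\<rho> p"] \<open>\<rho> p \<in> men M\<close> by simp
    qed
    from this[of \<mu> \<nu>] this[of \<nu> \<mu>] show ?thesis using st men by metis
  qed (use assms men in \<open>auto simp: man_optimal_def\<close>)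
qed

end

text \<open>A man who blocks with \<open>w\<close> is acceptable to her and prefers her, so he is a
  proposer, and so is her partner. Hence only comparisons within the proposers can create a blocking
  pair.\<close>

lemma stable_transfer:
  assumes "market M W R" "market M W R'"
    and men: "\<And>m. m \<in> men M \<Longrightarrow> R m = R' m"
    and acc: "\<And>w. w \<in> women W \<Longrightarrow> acceptable (R w) w = acceptable (R' w) w"
    and eq: "\<And>w. w \<in> women W \<Longrightarrow>
      R w \<inter> proposers M R \<mu> w \<times> proposers M R \<mu> w = R' w \<inter> proposers M R \<mu> w \<times> proposers M R \<mu> w"
    and st: "stable M W R \<mu>"
  shows "stable M W R' \<mu>"
proof -
  interpret R: market M W R by fact
  interpret R': market M W R' by fact
  have "\<not> pair_blocks R' \<mu> m w" if mw: "m \<in> men M" "w \<in> women W" for m w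
  proof
    assume "pair_blocks R' \<mu> m w"
    then have b: "(m, \<mu> w) \<in> R' w" "(w, \<mu> m) \<in> R m" using men mw by (auto simp: pair_blocks_def)
    have "(m, \<mu> w) \<in> R w"
    proof (cases "\<mu> w = w")
      case True
      then show ?thesis using b acc[OF mw(2)] by (auto simp: acceptable_def)
    next
      case False
      have acc_w: "(\<mu> w, w) \<in> R w" using R.stable_acceptable[OF st, of w] mw False by simp
      then have "(\<mu> w, w) \<in> R' w" using acc[OF mw(2)] by (auto simp: acceptable_def)
      then have "(m, w) \<in> R' w" using R'.R_trans[OF _ b(1)] mw by blast
      then have "(m, w) \<in> R w" using acc[OF mw(2)] by (auto simp: acceptable_def)
      then have "m \<in> proposers M R \<mu> w" using mw b by (auto simp: proposers_def)
      moreover have "\<mu> w \<in> proposers M R \<mu> w"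
        using acc_w R.stable_woman[OF st mw(2) False] R.stable_invol[OF st, of w] mw
        by (auto simp: proposers_def)
      ultimately show ?thesis using eq[OF mw(2)] b(1) by blast
    qed
    then show False using st mw b(2) by (auto simp: stable_def pair_blocks_def)
  qed
  moreover have "\<not> person_blocks R' \<mu> p" if "p \<in> men M \<union> women W" for p
    using st that men acc by (auto simp: stable_def person_blocks_def)
  ultimately show ?thesis using st by (auto simp: stable_def)
qed

text \<open>Let \<open>\<nu>\<close> be man-optimal for \<open>R'\<close>. All men weakly prefer it
  to \<open>\<mu>\<close>, which is stable for \<open>R'\<close>, so its proposers are among those
  of \<open>\<mu>\<close>. Thus \<open>\<nu>\<close> transfers back to \<open>R\<close>, is
  man-optimal there, and equals \<open>\<mu>\<close>.\<close>

lemma man_optimal_transfer: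
  assumes R: "market M W R" and R': "market M W R'"
    and men: "\<And>m. m \<in> men M \<Longrightarrow> R m = R' m"
    and acc: "\<And>w. w \<in> women W \<Longrightarrow> acceptable (R w) w = acceptable (R' w) w"
    and eq: "\<And>w. w \<in> women W \<Longrightarrow>
      R w \<inter> proposers M R \<mu> w \<times> proposers M R \<mu> w = R' w \<inter> proposers M R \<mu> w \<times> proposers M R \<mu> w"
    and opt: "man_optimal M W R \<mu>"
  shows "man_optimal M W R' \<mu>"
proof -
  interpret R: market M W R by fact
  interpret R': market M W R' by fact
  have st: "stable M W R \<mu>" using opt by (simp add: man_optimal_def)
  have st': "stable M W R' \<mu>" by (rule stable_transfer[OF R R' men acc eq st])
  obtain \<nu> where \<nu>: "man_optimal M W R' \<nu>" using R'.ex_man_optimal[OF st'] by blast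
  have "proposers M R' \<nu> w \<subseteq> proposers M R \<mu> w" if w: "w \<in> women W" for w
  proof
    fix m assume m: "m \<in> proposers M R' \<nu> w"
    then have mm: "m \<in> men M" and mw: "(m, w) \<in> R' w"
      and wm: "\<nu> m = w \<or> (w, \<nu> m) \<in> R m" using men by (auto simp: proposers_def)
    have "\<nu> m = \<mu> m \<or> (\<nu> m, \<mu> m) \<in> R m"
      using \<nu> st' mm men by (auto simp: man_optimal_def)
    then have "\<mu> m = w \<or> (w, \<mu> m) \<in> R m" using wm R.R_trans[of m w "\<nu> m" "\<mu> m"] mm by auto
    moreover have "(m, w) \<in> R w" using mw acc[OF w] by (auto simp: acceptable_def)
    ultimately show "m \<in> proposers M R \<mu> w" using mm by (simp add: proposers_def)
  qed
  then have eq': "R' w \<inter> proposers M R' \<nu> w \<times> proposers M R' \<nu> w =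
      R w \<inter> proposers M R' \<nu> w \<times> proposers M R' \<nu> w" if "w \<in> women W" for w
    using eq[OF that] that by blast
  have "stable M W R \<nu>"
    using \<nu> by (intro stable_transfer[OF R' R men[symmetric] acc[symmetric] eq'])
      (auto simp: man_optimal_def)
  then have "man_optimal M W R \<nu>"
    unfolding man_optimal_def
  proof (intro conjI allI impI)
    show "\<nu> p = p" if "p \<notin> men M \<union> women W" for p using \<nu> that by (simp add: man_optimal_def)
    fix \<rho> m assume \<rho>: "stable M W R \<rho>" and m: "m \<in> men M"
    have 1: "\<nu> m = \<mu> m \<or> (\<nu> m, \<mu> m) \<in> R m" using \<nu> st' m men by (auto simp: man_optimal_def)
    have 2: "\<mu> m = \<rho> m \<or> (\<mu> m, \<rho> m) \<in> R m" using opt \<rho> m by (auto simp: man_optimal_def)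
    show "\<nu> m = \<rho> m \<or> (\<nu> m, \<rho> m) \<in> R m"
      using 1 2 R.R_trans[of m "\<nu> m" "\<mu> m" "\<rho> m"] m by auto
  qed
  then have "\<nu> = \<mu>" using R.man_optimal_unique opt by blast
  then show ?thesis using \<nu> by simp
qed

section \<open>Thresholds and the rank gap\<close>

context market
begin

text \<open>The threshold condition, stated without jump lengths; single men impose no
  constraint.\<close>

definition closed_prefix :: "(person \<Rightarrow> person) \<Rightarrow> nat \<Rightarrow> bool" where
  "closed_prefix \<mu> t \<longleftrightarrow>
     (\<forall>i k. i \<in> {1..M} \<and> i \<le> t \<and> \<mu> (Man i) \<noteq> Man i \<and> (Man k, Man i) \<in> R (\<mu> (Man i)) \<longrightarrow> k \<le> t)"

lemma man_optimal_matches_all: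
  assumes "man_optimal M W R \<mu>" "stable M W R \<nu>" "m \<in> men M" "\<nu> m \<noteq> m"
  shows "\<mu> m \<noteq> m"
proof
  assume "\<mu> m = m"
  then have "(m, \<nu> m) \<in> R m" using assms unfolding man_optimal_def by metis
  then show False using stable_acceptable[OF assms(2), of m] R_asym[of m m "\<nu> m"] assms(3,4) by auto
qed

text \<open>Man \<open>n\<close> weakly prefers \<open>w\<close> to his partner in
  \<open>\<nu>\<close>, so \<open>w\<close> must do at least as well in \<open>\<nu>\<close> as with
  him.\<close>

lemma man_optimal_woman_pessimal:
  assumes opt: "man_optimal M W R \<mu>" and \<nu>: "stable M W R \<nu>"
    and w: "w \<in> women W" and n: "\<mu> w = Man n"
  obtains b where "\<nu> w = Man b" "b \<in> {1..M}" "b = n \<or> (Man b, Man n) \<in> R w"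
proof -
  have st: "stable M W R \<mu>" using opt by (simp add: man_optimal_def)
  have "Man n \<noteq> w" using w by (auto simp: women_def)
  then have m: "Man n \<in> men M" "(Man n, w) \<in> R w" "\<mu> (Man n) = w"
    using stable_woman[OF st w] stable_acceptable[OF st, of w] stable_invol[OF st, of w] w n by auto
  then have "w = \<nu> (Man n) \<or> (w, \<nu> (Man n)) \<in> R (Man n)"
    using opt \<nu> unfolding man_optimal_def by metis
  note * = woman_weakly_prefers[OF \<nu> m(1) w m(2) this]
  then have "\<nu> w \<in> men M" using stable_woman[OF \<nu> w] by blast
  then show thesis using * that by (auto simp: men_def)
qed

text \<open>Following \<open>\<mu>\<close> and then \<open>\<nu>\<close> maps the matched men up to
  \<open>l\<close> injectively, hence bijectively, to themselves. So no man up to \<open>l\<close>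
  is left for \<open>w\<close>, whose partner in \<open>\<mu>\<close> is
  \<open>n > l\<close>.\<close>

lemma closed_prefix_partner_gt:
  assumes opt: "man_optimal M W R \<mu>" and \<nu>: "stable M W R \<nu>"
    and w: "w \<in> women W" and n: "\<mu> w = Man n" and l: "closed_prefix \<mu> l" "l < n"
    and b: "\<nu> w = Man b"
  shows "l < b"
proof (rule ccontr)
  assume "\<not> l < b"
  have st: "stable M W R \<mu>" using opt by (simp add: man_optimal_def)
  let ?T = "{m \<in> men M. m \<in> Man ` {1..l} \<and> \<mu> m \<noteq> m}"
  have inv: "\<mu> (\<mu> m) = m" if "m \<in> ?T" for m using stable_invol[OF st] that by auto
  have T: "\<mu> ` ?T \<subseteq> women W" using stable_man[OF st] by auto
  \<comment> \<open>In \<open>\<nu>\<close> the partner of \<open>i\<close> gets \<open>i\<close> or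
    someone she prefers, whose index is at most \<open>l\<close> by closedness.\<close>
  have "\<nu> ` \<mu> ` ?T \<subseteq> ?T"
  proof
    fix m assume "m \<in> \<nu> ` \<mu> ` ?T"
    then obtain i where i: "Man i \<in> ?T" "m = \<nu> (\<mu> (Man i))" by auto
    have w': "\<mu> (Man i) \<in> women W" using i(1) T by blast
    obtain k where k: "\<nu> (\<mu> (Man i)) = Man k" "k \<in> {1..M}"
        "k = i \<or> (Man k, Man i) \<in> R (\<mu> (Man i))"
      using man_optimal_woman_pessimal[OF opt \<nu> w' inv[OF i(1)]] by blast
    have "i \<in> {1..M}" "i \<le> l" using i(1) by (auto simp: men_def)
    then have "k \<le> l" using k(3) l(1) i(1) unfolding closed_prefix_def by blast
    have km: "Man k \<in> men M" using k(2) by (auto simp: men_def)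
    have "\<nu> (Man k) = \<mu> (Man i)" using stable_invol[OF \<nu>, of "\<mu> (Man i)"] w' k(1) by simp
    then have "\<nu> (Man k) \<noteq> Man k" using w' by (auto simp: women_def)
    then have "\<mu> (Man k) \<noteq> Man k" by (rule man_optimal_matches_all[OF opt \<nu> km])
    then show "m \<in> ?T" using i(2) k km \<open>k \<le> l\<close> by auto
  qed
  moreover have "card ?T \<le> card (\<nu> ` \<mu> ` ?T)"
  proof -
    have "inj_on \<mu> ?T" by (rule inj_on_inverseI[of _ \<mu>]) (rule inv)
    moreover have "inj_on \<nu> (\<mu> ` ?T)"
      by (rule inj_on_inverseI[of _ \<nu>]) (use T stable_invol[OF \<nu>] in blast)
    ultimately show ?thesis by (simp add: card_image)
  qed
  ultimately have eq: "\<nu> ` \<mu> ` ?T = ?T" by (intro card_seteq) auto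
  have "Man b \<noteq> w" using w by (auto simp: women_def)
  then have bm: "Man b \<in> men M" "\<nu> (Man b) = w"
    using stable_woman[OF \<nu> w] stable_invol[OF \<nu>, of w] w b by auto
  then have "\<mu> (Man b) \<noteq> Man b"
    using man_optimal_matches_all[OF opt \<nu>] \<open>Man b \<noteq> w\<close> by metis
  then have "Man b \<in> ?T" using bm \<open>\<not> l < b\<close> by (auto simp: men_def)
  then obtain m where m: "m \<in> ?T" "Man b = \<nu> (\<mu> m)" using eq by blast
  then have "\<mu> m \<in> women W" using T by blast
  then have "\<mu> m = w" using bm(2) stable_invol[OF \<nu>, of "\<mu> m"] m(2) by simp
  then have "m = Man n" using inv[OF m(1)] n by metis
  then show False using m(1) l(2) by auto
qed

text \<open>\<open>n\<close> is the worst stable partner, and the best one has an index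
  \<open>b > l\<close>. The men from the best one down to just above \<open>n\<close> have index at
  most \<open>r\<close>; each \<open>c \<le> l\<close> among them is ranked below \<open>b\<close>
  and yields a pair in \<open>Z\<close>.\<close>

lemma stable_rank_gap_le:
  assumes opt: "man_optimal M W R \<mu>"
    and w: "w \<in> women W" and n: "\<mu> w = Man n"
    and l: "closed_prefix \<mu> l" "l < n" and r: "closed_prefix \<mu> r" "n \<le> r"
  defines "Z \<equiv> {(b, c). b \<in> {1..M} \<and> c \<in> {1..l} \<and> l < b \<and> (Man b, Man c) \<in> R w \<and> (Man c, Man n) \<in> R w}"
  shows "stable_rank_gap M W R w \<le> real (r - n) + real (n - Suc l) + real (card Z)"
proof -
  have st: "stable M W R \<mu>" using opt by (simp add: man_optimal_def)
  let ?S = "stable_partners M W R w"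
  have nw: "Man n \<noteq> w" using w by (auto simp: women_def)
  have nS: "Man n \<in> ?S" using st n nw by (auto simp: stable_partners_def)
  have wp: "w \<in> persons" using w by simp
  have nm: "Man n \<in> men M" "\<mu> (Man n) = w"
    using stable_woman[OF st w] stable_invol[OF st, of w] w n nw by auto
  have S: "\<exists>b\<in>{1..M}. x = Man b \<and> l < b \<and> (x = Man n \<or> (x, Man n) \<in> R w)" if x: "x \<in> ?S" for x
  proof -
    obtain \<nu> where \<nu>: "stable M W R \<nu>" "\<nu> w = x" using x by (auto simp: stable_partners_def)
    obtain b where "\<nu> w = Man b" "b \<in> {1..M}" "b = n \<or> (Man b, Man n) \<in> R w"
      by (rule man_optimal_woman_pessimal[OF opt \<nu>(1) w n])
    then show ?thesis using closed_prefix_partner_gt[OF opt \<nu>(1) w n l] \<nu>(2) by auto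
  qed
  have below: "x = Man n \<or> (x, Man n) \<in> R w" if "x \<in> ?S" for x using S[OF that] by auto
  have least: "least_preferred (R w) ?S = Man n"
    unfolding least_preferred_def
  proof (rule the_equality)
    show "Man n \<in> ?S \<and> (\<forall>b\<in>?S. b \<noteq> Man n \<longrightarrow> (b, Man n) \<in> R w)" using nS below by auto
    fix a assume a: "a \<in> ?S \<and> (\<forall>b\<in>?S. b \<noteq> a \<longrightarrow> (b, a) \<in> R w)"
    show "a = Man n"
    proof (rule ccontr)
      assume "a \<noteq> Man n"
      then have "(a, Man n) \<in> R w" "(Man n, a) \<in> R w" using a nS below[of a] by auto
      then show False using R_asym[OF wp] by metis
    qed
  qed
  have subS: "?S \<subseteq> men M" using S by (fastforce simp: men_def)
  have "\<exists>a\<in>?S. \<forall>b\<in>?S. b \<noteq> a \<longrightarrow> (a, b) \<in> R w"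
  proof (rule ex_top)
    show "finite ?S" using subS by (rule finite_subset) simp
    show "total_on ?S (R w)" using total_on_subset[OF total_R[OF wp]] subS w by auto
  qed (use nS trans_R irrefl_R wp in auto)
  then obtain a where a: "a \<in> ?S" "\<forall>b\<in>?S. b \<noteq> a \<longrightarrow> (a, b) \<in> R w" by blast
  have most: "most_preferred (R w) ?S = a"
    unfolding most_preferred_def
  proof (rule the_equality)
    show "a \<in> ?S \<and> (\<forall>b\<in>?S. b \<noteq> a \<longrightarrow> (a, b) \<in> R w)" using a by auto
    fix x assume x: "x \<in> ?S \<and> (\<forall>b\<in>?S. b \<noteq> x \<longrightarrow> (x, b) \<in> R w)"
    show "x = a"
    proof (rule ccontr)
      assume "x \<noteq> a"
      then have "(x, a) \<in> R w" "(a, x) \<in> R w" using a x by auto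
      then show False using R_asym[OF wp] by metis
    qed
  qed
  obtain b where b: "a = Man b" "b \<in> {1..M}" "l < b" using S[OF a(1)] by blast
  let ?above = "\<lambda>x. {c \<in> acceptable (R w) w. (c, x) \<in> R w}"
  \<comment> \<open>If the two partners differ, \<open>?X\<close> contains \<open>a\<close> but not
    \<open>n\<close>, so its size is the rank difference.\<close>
  let ?X = "?above (Man n) - ?above a"
  have dom: "acceptable (R w) w \<subseteq> men M"
    using dom_R[OF wp] R_irrefl[OF wp] w by (auto simp: acceptable_def)
  have fin: "finite (?above x)" for x using dom by (auto intro: finite_subset[of _ "men M"])
  have "card (?above (Man n)) \<le> card (?above a \<union> ?X)" using fin by (intro card_mono) auto
  also have "\<dots> \<le> card (?above a) + card ?X" by (rule card_Un_le)
  finally have "stable_rank_gap M W R w \<le> real (card ?X)"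
    by (simp add: stable_rank_gap_def least most rank_def)
  also have "card ?X \<le> card (Man ` ({l<..r} - {n}) \<union> (\<lambda>(b, c). Man c) ` Z)"
  proof (rule card_mono)
    have "Z \<subseteq> {1..M} \<times> {1..l}" by (auto simp: Z_def)
    then have "finite Z" by (rule finite_subset) simp
    then show "finite (Man ` ({l<..r} - {n}) \<union> (\<lambda>(b, c). Man c) ` Z)" by simp
    show "?X \<subseteq> Man ` ({l<..r} - {n}) \<union> (\<lambda>(b, c). Man c) ` Z"
    proof
      fix x assume x: "x \<in> ?X"
      then obtain c where c: "x = Man c" "c \<in> {1..M}" using dom by (auto simp: men_def)
      have cn: "(Man c, Man n) \<in> R w" using x c by simp
      have "n \<in> {1..M}" using nm(1) by (auto simp: men_def)
      then have "c \<le> r" using r cn nm(2) nw unfolding closed_prefix_def by metis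
      have "c \<noteq> n" using cn R_irrefl[OF wp] by auto
      show "x \<in> Man ` ({l<..r} - {n}) \<union> (\<lambda>(b, c). Man c) ` Z"
      proof (cases "l < c")
        case True
        then show ?thesis using c \<open>c \<le> r\<close> \<open>c \<noteq> n\<close> by auto
      next
        case False
        have "(Man c, a) \<notin> R w" using x c by auto
        then have "(Man b, Man c) \<in> R w"
          using R_total[OF wp, of "Man c" "Man b"] b c False w by (auto simp: men_def)
        then have "(b, c) \<in> Z" using b(2,3) c(2) cn False by (auto simp: Z_def)
        then show ?thesis using c(1) by force
      qed
    qed
  qed
  also have "\<dots> \<le> card (Man ` ({l<..r} - {n})) + card ((\<lambda>(b, c). Man c) ` Z)"
    by (rule card_Un_le)
  also have "card (Man ` ({l<..r} - {n})) \<le> card ({l<..r} - {n})" by (rule card_image_le) simp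
  also have "card ({l<..r} - {n}) = (r - n) + (n - Suc l)" using l(2) r(2) by simp
  also have "card ((\<lambda>(b, c). Man c) ` Z) \<le> card Z"
  proof (rule card_image_le)
    have "Z \<subseteq> {1..M} \<times> {1..l}" by (auto simp: Z_def)
    then show "finite Z" by (rule finite_subset) simp
  qed
  finally show ?thesis by simp
qed

end

section \<open>Conditioning on the man-optimal matching\<close>

locale random_lists =
  fixes M W :: nat and A :: "nat \<Rightarrow> person set" and P :: "nat \<Rightarrow> person rel"
    and D :: "nat \<Rightarrow> person rel pmf"
  assumes men_prefs: "\<And>i. i \<in> {1..M} \<Longrightarrow> pref_order M W (Man i) (P i)"
    and women_prefs: "\<And>j r. j \<in> {1..W} \<Longrightarrow> r \<in> set_pmf (D j) \<Longrightarrow>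
           pref_order M W (Woman j) r \<and> acceptable r (Woman j) = A j"
    and regular: "\<And>j. j \<in> {1..W} \<Longrightarrow> regular (A j) (D j)"
begin

abbreviation profiles :: "(nat \<Rightarrow> person rel) pmf" where
  "profiles \<equiv> Pi_pmf {1..W} {} D"

lemma woman_order:
  assumes "j \<in> {1..W}" "r \<in> set_pmf (D j)"
  shows "trans r" "irrefl r" "total_on (insert (Woman j) (men M)) r"
    "r \<subseteq> insert (Woman j) (men M) \<times> insert (Woman j) (men M)"
    "acceptable r (Woman j) = A j"
  using women_prefs[OF assms] by (auto simp: pref_order_def strict_linear_order_on_def)

lemma A_subset: "j \<in> {1..W} \<Longrightarrow> A j \<subseteq> men M"
proof -
  assume j: "j \<in> {1..W}"
  obtain r where r: "r \<in> set_pmf (D j)" using set_pmf_not_empty[of "D j"] by blast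
  show ?thesis
    using woman_order[OF j r] by (auto simp: acceptable_def irrefl_def)
qed

lemma mem_A_iff: "j \<in> {1..W} \<Longrightarrow> r \<in> set_pmf (D j) \<Longrightarrow> x \<in> A j \<longleftrightarrow> (x, Woman j) \<in> r"
  using woman_order(5)[of j r] unfolding acceptable_def by blast

lemma finite_D:
  assumes "j \<in> {1..W}"
  shows "finite (set_pmf (D j))"
proof (rule finite_subset)
  show "set_pmf (D j) \<subseteq> Pow (insert (Woman j) (men M) \<times> insert (Woman j) (men M))"
    using woman_order(4)[OF assms] by blast
qed simp

lemma regular_order: "j \<in> {1..W} \<Longrightarrow> regular_order (A j) (D j)"
proof
  assume j: "j \<in> {1..W}"
  show "Defs.regular (A j) (D j)" using regular[OF j] .
  show "finite (A j)" using A_subset[OF j] finite_subset finite_men by blast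
  show "finite (set_pmf (D j))" using finite_D[OF j] .
  show "total_on (A j) r" if "r \<in> set_pmf (D j)" for r
    using woman_order(3)[OF j that] A_subset[OF j] by (auto simp: total_on_def)
qed (use woman_order in auto)

lemma finite_profiles: "finite (set_pmf profiles)"
  by (intro finite_set_Pi_pmf finite_D) auto

lemma market_profile: "Q \<in> set_pmf profiles \<Longrightarrow> market M W (profile P Q)"
proof
  fix p assume Q: "Q \<in> set_pmf profiles" and p: "p \<in> men M \<union> women W"
  have "Q j \<in> set_pmf (D j)" if "j \<in> {1..W}" for j using set_Pi_pmfD[OF Q _ that] by simp
  then show "pref_order M W p (profile P Q p)"
    using p men_prefs women_prefs by (auto simp: men_def women_def)
qed

end

text \<open>Real-valued, multiplied-out ratio bounds; infinite ratios are treated in the final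
  theorem.\<close>

locale random_market = random_lists +
  fixes u :: "nat \<Rightarrow> real"
  assumes u_nonneg: "\<And>k. 0 \<le> u k"
    and swap_le: "\<And>i j k. j \<in> {1..W} \<Longrightarrow> 1 \<le> i \<Longrightarrow> 1 \<le> k \<Longrightarrow> i + k \<le> M \<Longrightarrow>
      Man i \<in> A j \<Longrightarrow> Man (i + k) \<in> A j \<Longrightarrow>
      measure_pmf.prob (D j) {r. (Man (i + k), Man i) \<in> r} \<le>
      u k * measure_pmf.prob (D j) {r. (Man i, Man (i + k)) \<in> r}"
begin

text \<open>With \<open>p\<close> the probability that \<open>i\<close> beats \<open>i + k\<close>,
  the ratio bound reads \<open>1 - p \<le> u k * p\<close>, hence
  \<open>1 \<le> (1 + u k) * p \<le> exp (u k) * p\<close>.\<close>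

lemma prob_prefers_later_le:
  assumes "j \<in> {1..W}" "1 \<le> i" "1 \<le> k" "i + k \<le> M" "Man i \<in> A j" "Man (i + k) \<in> A j"
  shows "measure_pmf.prob (D j) {r. (Man (i + k), Man i) \<in> r} \<le> u k"
    and "exp (- u k) \<le> measure_pmf.prob (D j) {r. (Man i, Man (i + k)) \<in> r}"
proof -
  interpret regular_order "A j" "D j" using assms(1) by (rule regular_order)
  let ?p = "measure_pmf.prob (D j) {r. (Man i, Man (i + k)) \<in> r}"
  have le: "measure_pmf.prob (D j) {r. (Man (i + k), Man i) \<in> r} \<le> u k * ?p"
    by (rule swap_le[OF assms])
  also have "\<dots> \<le> u k * 1" using u_nonneg by (intro mult_left_mono) auto
  finally show "measure_pmf.prob (D j) {r. (Man (i + k), Man i) \<in> r} \<le> u k" by simp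
  have "1 - ?p = measure_pmf.prob (D j) {r. (Man (i + k), Man i) \<in> r}"
    using prob_swap[of "Man (i + k)" "Man i"] assms by auto
  then have "1 \<le> (1 + u k) * ?p" using le by (simp add: algebra_simps)
  also have "\<dots> \<le> exp (u k) * ?p" by (intro mult_right_mono exp_ge_add_one_self) simp
  finally show "exp (- u k) \<le> ?p" by (simp add: exp_minus field_simps)
qed

end

text \<open>One conditioning class, represented by the profile \<open>Q0\<close>: the man-optimal
  matching and the order of every woman on her proposers are those of \<open>Q0\<close>.\<close>

locale conditioned_market = random_market +
  fixes Q0 :: "nat \<Rightarrow> person rel" and \<mu> :: "person \<Rightarrow> person"
  assumes Q0: "Q0 \<in> set_pmf profiles"
    and optimal: "man_optimal M W (profile P Q0) \<mu>"
begin

definition C :: "nat \<Rightarrow> person set" where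
  "C j = proposers M (profile P Q0) \<mu> (Woman j)"

definition K :: "nat \<Rightarrow> person rel set" where
  "K j = {r. r \<inter> C j \<times> C j = Q0 j \<inter> C j \<times> C j}"

definition D' :: "nat \<Rightarrow> person rel pmf" where
  "D' j = cond_pmf (D j) (K j)"

lemma Q0_mem: "j \<in> {1..W} \<Longrightarrow> Q0 j \<in> set_pmf (D j)"
  using set_Pi_pmfD[OF Q0] by simp

lemma K_ne: "j \<in> {1..W} \<Longrightarrow> set_pmf (D j) \<inter> K j \<noteq> {}"
  using Q0_mem by (auto simp: K_def)

lemma set_D': "j \<in> {1..W} \<Longrightarrow> set_pmf (D' j) = set_pmf (D j) \<inter> K j"
  unfolding D'_def using K_ne by (intro set_cond_pmf)

lemma cond_profiles: "cond_pmf profiles (Pi {1..W} K) = Pi_pmf {1..W} {} D'"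
  unfolding D'_def by (rule cond_pmf_Pi_pmf) (use K_ne in auto)

sublocale M0: market M W "profile P Q0"
  using Q0 by (rule market_profile)

lemma stable_\<mu>: "stable M W (profile P Q0) \<mu>"
  using optimal by (simp add: man_optimal_def)

lemma optimal_class:
  assumes Q: "Q \<in> set_pmf profiles" "Q \<in> Pi {1..W} K"
  shows "man_optimal M W (profile P Q) \<mu>"
proof (rule man_optimal_transfer[OF market_profile[OF Q0] market_profile[OF Q(1)] _ _ _ optimal])
  show "profile P Q0 m = profile P Q m" if "m \<in> men M" for m using that by (auto simp: men_def)
  fix w assume "w \<in> women W"
  then obtain j where j: "w = Woman j" "j \<in> {1..W}" by (auto simp: women_def)
  have "Q j \<in> set_pmf (D j)" using set_Pi_pmfD[OF Q(1) _ j(2)] by simp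
  then show "acceptable (profile P Q0 w) w = acceptable (profile P Q w) w"
    using woman_order(5)[OF j(2)] Q0_mem[OF j(2)] j(1) by simp
  show "profile P Q0 w \<inter> proposers M (profile P Q0) \<mu> w \<times> proposers M (profile P Q0) \<mu> w =
      profile P Q w \<inter> proposers M (profile P Q0) \<mu> w \<times> proposers M (profile P Q0) \<mu> w"
    using Q(2) j by (auto simp: K_def C_def Pi_def)
qed

text \<open>The partner tops the proposers because any other proposer strictly prefers the woman to
  his own match and would otherwise block.\<close>

lemma matched_pair:
  assumes "i \<in> {1..M}" "\<mu> (Man i) = Woman j"
  shows "j \<in> {1..W}" "\<mu> (Woman j) = Man i" "Man i \<in> A j" "Man i \<in> C j" "C j \<subseteq> A j"
    "\<And>s. s \<in> C j \<Longrightarrow> s \<noteq> Man i \<Longrightarrow> (Man i, s) \<in> Q0 j"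
proof -
  have m: "Man i \<in> men M" using assms(1) by (simp add: men_def)
  have "Woman j \<in> women W" using M0.stable_man[OF stable_\<mu> m] assms(2) by simp
  then show j: "j \<in> {1..W}" by (auto simp: women_def)
  have w: "Woman j \<in> women W" using j by (simp add: women_def)
  show \<mu>j: "\<mu> (Woman j) = Man i" using M0.stable_invol[OF stable_\<mu>, of "Man i"] m assms(2) by simp
  have acc: "(Man i, Woman j) \<in> Q0 j"
    using M0.stable_acceptable[OF stable_\<mu>, of "Woman j"] w \<mu>j by simp
  then show "Man i \<in> A j" using mem_A_iff[OF j Q0_mem[OF j]] by simp
  show "Man i \<in> C j" using m acc assms(2) by (simp add: C_def proposers_def)
  show "C j \<subseteq> A j" using mem_A_iff[OF j Q0_mem[OF j]] by (auto simp: C_def proposers_def)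
  fix s assume s: "s \<in> C j" "s \<noteq> Man i"
  then have sm: "s \<in> men M" "\<mu> s = Woman j \<or> (Woman j, \<mu> s) \<in> profile P Q0 s"
    by (auto simp: C_def proposers_def)
  have "\<mu> s \<noteq> Woman j"
    using M0.stable_invol[OF stable_\<mu>, of s] sm(1) \<mu>j s(2) by auto
  then show "(Man i, s) \<in> Q0 j"
    using M0.stable_no_block[OF stable_\<mu> sm(1) w] sm(2) \<mu>j by simp
qed

text \<open>The partner tops the order on \<open>C j\<close>, so fixing that order amounts, on the
  support, to a top event. He is removed from the set because \<open>top_event\<close> would
  otherwise require \<open>(Man i, Man i)\<close>.\<close>

lemma D'_eq_top_event:
  assumes "i \<in> {1..M}" "\<mu> (Man i) = Woman j"
  defines "C' \<equiv> C j - {Man i}"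
  shows "D' j = cond_pmf (D j) (top_event (Man i) C' (Q0 j \<inter> C' \<times> C'))"
    and "set_pmf (D j) \<inter> top_event (Man i) C' (Q0 j \<inter> C' \<times> C') \<noteq> {}"
proof -
  note mp = matched_pair[OF assms(1,2)]
  let ?T = "top_event (Man i) C' (Q0 j \<inter> C' \<times> C')"
  interpret regular_order "A j" "D j" using mp(1) by (rule regular_order)
  have top0: "(Man i, s) \<in> Q0 j" if "s \<in> C'" for s using mp(6) that by (auto simp: C'_def)
  have CC: "C j = insert (Man i) C'" using mp(4) by (auto simp: C'_def)
  have *: "r \<in> K j \<longleftrightarrow> r \<in> ?T" if r: "r \<in> set_pmf (D j)" for r
  proof
    assume "r \<in> K j"
    then have rK: "r \<inter> C j \<times> C j = Q0 j \<inter> C j \<times> C j" by (simp add: K_def)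
    have "(Man i, s) \<in> r" if "s \<in> C'" for s using top0[OF that] that rK CC by blast
    moreover have "r \<inter> C' \<times> C' = Q0 j \<inter> C' \<times> C'" using rK CC by blast
    ultimately show "r \<in> ?T" by (simp add: top_event_def)
  next
    assume "r \<in> ?T"
    then have t: "\<And>s. s \<in> C' \<Longrightarrow> (Man i, s) \<in> r" and rK: "r \<inter> C' \<times> C' = Q0 j \<inter> C' \<times> C'"
      by (auto simp: top_event_def)
    have "(x, y) \<in> r \<longleftrightarrow> (x, y) \<in> Q0 j" if "x \<in> C j" "y \<in> C j" for x y
    proof (cases "x = Man i \<or> y = Man i")
      case True
      then show ?thesis
        using t top0 that CC asym[OF r] asym[OF Q0_mem[OF mp(1)]] by (metis insertE)
    next
      case False
      then have "x \<in> C'" "y \<in> C'" using that CC by auto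
      then show ?thesis using rK by blast
    qed
    then show "r \<in> K j" by (auto simp: K_def)
  qed
  then have eq: "set_pmf (D j) \<inter> K j = set_pmf (D j) \<inter> ?T" by blast
  show "set_pmf (D j) \<inter> ?T \<noteq> {}" using K_ne[OF mp(1)] eq by simp
  show "D' j = cond_pmf (D j) ?T"
    unfolding D'_def by (rule cond_pmf_eqI[OF eq K_ne[OF mp(1)]])
qed

lemma mem_A_if_preferred:
  assumes "j \<in> {1..W}" "r \<in> set_pmf (D j)" "(x, y) \<in> r" "y \<in> A j"
  shows "x \<in> A j"
  using assms woman_order(1)[OF assms(1,2)] by (auto simp: mem_A_iff dest: transD)

text \<open>The inserted 0 is the value when no later man is preferred; in particular the empty
  relation, which stands in for the list at a single man, never jumps.\<close>

definition jump :: "nat \<Rightarrow> person rel \<Rightarrow> nat" where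
  "jump i r = Max (insert 0 {k. 1 \<le> k \<and> i + k \<le> M \<and> (Man (i + k), Man i) \<in> r})"

lemma finite_jump_set: "finite {k. 1 \<le> k \<and> i + k \<le> M \<and> (Man (i + k), Man i) \<in> r}"
  by (rule finite_subset[of _ "{..M}"]) auto

lemma jump_le_M: "jump i r \<le> M"
  unfolding jump_def using finite_jump_set by (subst Max_le_iff) auto

lemma jump_ge: "1 \<le> k \<Longrightarrow> i + k \<le> M \<Longrightarrow> (Man (i + k), Man i) \<in> r \<Longrightarrow> k \<le> jump i r"
  unfolding jump_def using finite_jump_set by (intro Max_ge) auto

lemma jump_mem:
  assumes "1 \<le> k" "jump i r = k"
  shows "i + k \<le> M \<and> (Man (i + k), Man i) \<in> r"
proof -
  have "jump i r \<in> insert 0 {k. 1 \<le> k \<and> i + k \<le> M \<and> (Man (i + k), Man i) \<in> r}"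
    unfolding jump_def using finite_jump_set by (intro Max_in) auto
  then show ?thesis using assms by auto
qed

lemma jump_empty [simp]: "jump i {} = 0"
  by (simp add: jump_def)

text \<open>A jump of length \<open>k\<close> requires that \<open>i + k\<close> beats
  \<open>i\<close>, which regularity bounds. If \<open>i + k\<close> is unacceptable the event is
  null, since whoever beats an acceptable man is acceptable.\<close>

lemma prob_jump_D':
  assumes i: "i \<in> {1..M}" "\<mu> (Man i) = Woman j" and k: "1 \<le> k"
  shows "measure_pmf.prob (D' j) {r. jump i r = k} \<le> u k"
proof -
  note mp = matched_pair[OF i]
  interpret regular_order "A j" "D j" using mp(1) by (rule regular_order)
  have le: "measure_pmf.prob (D' j) {r. jump i r = k} \<le>
      measure_pmf.prob (D' j) {r. (Man (i + k), Man i) \<in> r}"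
    using jump_mem[OF k] by (intro measure_pmf.finite_measure_mono) auto
  show ?thesis
  proof (cases "i + k \<le> M \<and> Man (i + k) \<in> A j")
    case True
    have "C j - {Man i} \<subseteq> A j" using mp(5) by blast
    then have "measure_pmf.prob (D' j) {r. (Man (i + k), Man i) \<in> r} \<le>
        measure_pmf.prob (D j) {r. (Man (i + k), Man i) \<in> r}"
      unfolding D'_eq_top_event(1)[OF i]
      using D'_eq_top_event(2)[OF i] mp(3) True k by (intro prob_beats_given_top_event) auto
    also have "\<dots> \<le> u k" using True k mp i(1) by (intro prob_prefers_later_le) auto
    finally show ?thesis using le by simp
  next
    case False
    have "measure_pmf.prob (D' j) {r. jump i r = k} \<le> measure_pmf.prob (D' j) {}"
    proof (rule prob_le_mono_support)
      fix r assume r: "r \<in> set_pmf (D' j)" "r \<in> {r. jump i r = k}"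
      then have "r \<in> set_pmf (D j)" using set_D'[OF mp(1)] by simp
      then show "r \<in> {}"
        using mem_A_if_preferred[OF mp(1) _ _ mp(3)] jump_mem[OF k, of i r] r(2) False by blast
    qed
    then show ?thesis using u_nonneg[of k] by simp
  qed
qed

text \<open>The jump is at most \<open>d\<close> as soon as \<open>i\<close> beats every acceptable
  \<open>i + k\<close> with \<open>k > d\<close>.\<close>

lemma prob_short_jump_D':
  assumes i: "i \<in> {1..M}" "\<mu> (Man i) = Woman j"
  shows "exp (- (\<Sum>k\<in>{d<..M}. u k)) \<le> measure_pmf.prob (D' j) {r. jump i r \<le> d}"
proof -
  note mp = matched_pair[OF i]
  interpret regular_order "A j" "D j" using mp(1) by (rule regular_order)
  define N where "N = {k \<in> {d<..M}. i + k \<le> M \<and> Man (i + k) \<in> A j}"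
  define T where "T = (\<lambda>k. Man (i + k)) ` N"
  \<comment> \<open>\<open>v\<close> recovers the weight \<open>u k\<close> from the man
    \<open>i + k\<close>.\<close>
  define v where "v = (\<lambda>a. case a of Man l \<Rightarrow> u (l - i) | Woman _ \<Rightarrow> 0)"
  have C': "C j - {Man i} \<subseteq> A j" using mp(5) by blast
  have "(\<Sum>a\<in>T. v a) = (\<Sum>k\<in>N. u k)"
    unfolding T_def by (subst sum.reindex) (auto simp: inj_on_def v_def)
  also have "\<dots> \<le> (\<Sum>k\<in>{d<..M}. u k)"
    by (intro sum_mono2) (auto simp: N_def u_nonneg)
  finally have "exp (- (\<Sum>k\<in>{d<..M}. u k)) \<le> exp (- (\<Sum>a\<in>T. v a))" by simp
  also have "\<dots> \<le> measure_pmf.prob (D' j) {r. \<forall>a\<in>T. (Man i, a) \<in> r}"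
    unfolding D'_eq_top_event(1)[OF i]
  proof (rule prob_beats_all_given_top_event[OF mp(3) C' D'_eq_top_event(2)[OF i]])
    show "finite T" by (simp add: T_def N_def)
    show "T \<subseteq> A j - {Man i}" by (auto simp: T_def N_def)
    fix a assume "a \<in> T"
    then obtain k where "a = Man (i + k)" "k \<in> N" by (auto simp: T_def)
    then show "exp (- v a) \<le> measure_pmf.prob (D j) {r. (Man i, a) \<in> r}"
      using prob_prefers_later_le(2)[OF mp(1), of i k] mp(3) i(1) by (auto simp: N_def v_def)
  qed
  also have "\<dots> \<le> measure_pmf.prob (D' j) {r. jump i r \<le> d}"
  proof (rule prob_le_mono_support)
    fix r assume "r \<in> set_pmf (D' j)" and r: "r \<in> {r. \<forall>a\<in>T. (Man i, a) \<in> r}"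
    then have rD: "r \<in> set_pmf (D j)" using set_D'[OF mp(1)] by simp
    show "r \<in> {r. jump i r \<le> d}"
    proof (rule ccontr)
      assume "r \<notin> {r. jump i r \<le> d}"
      then have k: "d < jump i r" by simp
      have jm: "i + jump i r \<le> M" "(Man (i + jump i r), Man i) \<in> r"
        using jump_mem[of "jump i r" i r] k by auto
      then have "jump i r \<in> N"
        using mem_A_if_preferred[OF mp(1) rD jm(2) mp(3)] k by (auto simp: N_def)
      then have "(Man i, Man (i + jump i r)) \<in> r" using r by (auto simp: T_def)
      then show False using jm(2) asym[OF rD] by blast
    qed
  qed
  finally show ?thesis .
qed

definition matched_men :: "nat set" where
  "matched_men = {i \<in> {1..M}. \<mu> (Man i) \<noteq> Man i}"

definition partner :: "nat \<Rightarrow> nat" where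
  "partner i = (case \<mu> (Man i) of Woman j \<Rightarrow> j | Man _ \<Rightarrow> 0)"

lemma partner:
  assumes "i \<in> matched_men"
  shows "i \<in> {1..M}" "\<mu> (Man i) = Woman (partner i)"
  using assms M0.stable_man[OF stable_\<mu>, of "Man i"]
  by (auto simp: matched_men_def partner_def men_def women_def)

text \<open>The lists are indexed by the men instead of the women, because the scans run over the
  indices of the men.\<close>

definition E :: "nat \<Rightarrow> person rel pmf" where
  "E i = (if i \<in> matched_men then D' (partner i) else return_pmf {})"

sublocale jumps E jump M u
proof
  show "finite (set_pmf (E i))" for i
    using set_D'[of "partner i"] matched_pair(1)[of i "partner i"] partner[of i] finite_D
    by (auto simp: E_def)
  show "measure_pmf.prob (E i) {x. jump i x = k} \<le> u k" if "1 \<le> k" for i k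
    using prob_jump_D'[of i "partner i"] partner[of i] u_nonneg[of k] that by (auto simp: E_def)
  have "0 \<le> (\<Sum>k\<in>{d<..M}. u k)" for d by (intro sum_nonneg) (simp add: u_nonneg)
  then show "exp (- (\<Sum>k\<in>{d<..M}. u k)) \<le> measure_pmf.prob (E i) {x. jump i x \<le> d}" for i d
    using prob_short_jump_D'[of i "partner i"] partner[of i] by (auto simp: E_def)
qed (simp_all add: u_nonneg jump_le_M)

text \<open>Distinct matched men have distinct partners, so their lists stay independent; single men
  contribute deterministic coordinates.\<close>

lemma map_profiles_E:
  "map_pmf (\<lambda>Q i. if i \<in> matched_men then Q (partner i) else {}) (Pi_pmf {1..W} {} D') =
    Pi_pmf {1..M} {} E"
proof -
  have inj: "inj_on partner matched_men"
  proof (rule inj_onI)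
    fix i i' assume i: "i \<in> matched_men" "i' \<in> matched_men" "partner i = partner i'"
    have "\<mu> (Woman (partner i)) = Man i" by (rule matched_pair(2)[OF partner[OF i(1)]])
    moreover have "\<mu> (Woman (partner i')) = Man i'" by (rule matched_pair(2)[OF partner[OF i(2)]])
    ultimately show "i = i'" using i(3) by (metis person.inject(1))
  qed
  have fin: "finite matched_men" by (simp add: matched_men_def)
  have sub: "partner ` matched_men \<subseteq> {1..W}"
  proof
    fix j assume "j \<in> partner ` matched_men"
    then obtain i where i: "i \<in> matched_men" "j = partner i" by blast
    show "j \<in> {1..W}" using matched_pair(1)[OF partner] i by simp
  qed
  have "map_pmf (\<lambda>Q i. if i \<in> matched_men then Q (partner i) else {}) (Pi_pmf {1..W} {} D') =
      Pi_pmf matched_men {} (\<lambda>i. D' (partner i))"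
    by (rule map_pmf_Pi_pmf_reindex[OF fin finite_atLeastAtMost inj sub])
  also have "\<dots> = Pi_pmf matched_men {} E"
    by (rule Pi_pmf_cong) (auto simp: E_def)
  also have "\<dots> = Pi_pmf {1..M} {} E"
    by (rule Pi_pmf_subset'[symmetric]) (auto simp: E_def matched_men_def)
  finally show ?thesis .
qed

end

section \<open>Expected thresholds and crossings within a class\<close>

lemma sum_differences_across_le:
  fixes u :: "nat \<Rightarrow> real"
  assumes "\<And>k. 0 \<le> u k"
  shows "(\<Sum>(b, c)\<in>{a..M} \<times> {1..<a}. u (b - c)) \<le> (\<Sum>k=1..M. real k * u k)"
proof -
  \<comment> \<open>A pair \<open>c < a \<le> b\<close> at distance \<open>k\<close> is coded by
    \<open>k\<close> and the offset \<open>a - 1 - c < k\<close>, so each \<open>k\<close> occurs at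
    most \<open>k\<close> times.\<close>
  let ?G = "{a..M} \<times> {1..<a}" and ?f = "\<lambda>(b, c). (b - c, a - 1 - c)"
  have inj: "inj_on ?f ?G" by (auto simp: inj_on_def)
  have "(\<Sum>(b, c)\<in>?G. u (b - c)) = (\<Sum>(k, i)\<in>?f ` ?G. u k)"
    by (subst sum.reindex[OF inj]) (auto intro!: sum.cong)
  also have "\<dots> \<le> (\<Sum>(k, i)\<in>Sigma {1..M} (\<lambda>k. {..<k}). u k)"
    using assms by (intro sum_mono2) auto
  also have "\<dots> = (\<Sum>k=1..M. real k * u k)"
    by (subst sum.Sigma[symmetric]) auto
  finally show ?thesis .
qed

context conditioned_market
begin

text \<open>The scan starts at index 1 with end \<open>n\<close>, since a threshold must be closed
  under the jumps of all men up to it.\<close>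

definition upper :: "nat \<Rightarrow> (nat \<Rightarrow> person rel) \<Rightarrow> nat" where
  "upper n Q = right_end (\<lambda>i. jump i (Q i)) 0 n M"

text \<open>\<open>lower\<close> is one more than the threshold \<open>l\<close>.\<close>

definition lower :: "nat \<Rightarrow> (nat \<Rightarrow> person rel) \<Rightarrow> nat" where
  "lower n Q = left_end (\<lambda>i. jump i (Q i)) n (n - 1)"

definition crossings :: "nat \<Rightarrow> nat \<Rightarrow> person rel \<Rightarrow> (nat \<times> nat) set" where
  "crossings n a r = {(b, c) \<in> {a..M} \<times> {1..<a}. (Man b, Man c) \<in> r \<and> (Man c, Man n) \<in> r}"

lemma expectation_upper:
  "measure_pmf.expectation (Pi_pmf {1..M} {} E) (\<lambda>Q. real (upper n Q - n)) \<le> U2 * exp U1"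
proof -
  have "{0<..0 + M} = {1..M}" by auto
  then show ?thesis
    using expectation_right_end[of 0 M "{}" n] rpot_le[of "n - 0"] by (simp add: upper_def)
qed

text \<open>\<open>lower n\<close> reads only coordinates below \<open>n\<close>, so the expectation
  may be taken over these alone.\<close>

lemma expectation_lower:
  assumes n: "n \<in> {1..M}"
  shows "measure_pmf.expectation (Pi_pmf {1..M} {} E) (\<lambda>Q. real (n - lower n Q)) \<le> U2 * exp U1"
proof -
  have "Pi_pmf {1..n - 1} {} E =
      map_pmf (\<lambda>f x. if x \<in> {1..n - 1} then f x else {}) (Pi_pmf {1..M} {} E)"
    using n by (intro Pi_pmf_subset) auto
  then have "measure_pmf.expectation (Pi_pmf {1..n - 1} {} E) (\<lambda>Q. real (n - lower n Q)) =
      measure_pmf.expectation (Pi_pmf {1..M} {} E)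
        (\<lambda>Q. real (n - lower n (\<lambda>x. if x \<in> {1..n - 1} then Q x else {})))"
    by simp
  moreover have "lower n (\<lambda>x. if x \<in> {1..n - 1} then Q x else {}) = lower n Q" for Q
    unfolding lower_def by (rule left_end_cong) auto
  ultimately have "measure_pmf.expectation (Pi_pmf {1..M} {} E) (\<lambda>Q. real (n - lower n Q)) =
      measure_pmf.expectation (Pi_pmf {1..n - 1} {} E) (\<lambda>Q. real (n - lower n Q))"
    by simp
  also have "\<dots> \<le> lpot (n - (n - 1))"
    using expectation_left_end[of "n - 1" n "{}"] n unfolding lower_def by auto
  also have "\<dots> \<le> U2 * exp U1" using n by (intro lpot_le) auto
  finally show ?thesis .
qed

lemma prob_crossing:
  assumes n: "n \<in> {1..M}" "\<mu> (Man n) = Woman j" and bc: "c \<in> {1..<b}" "b \<le> M"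
  shows "measure_pmf.prob (D' j) {r. (Man b, Man c) \<in> r \<and> (Man c, Man n) \<in> r} \<le> u (b - c)"
proof -
  note mp = matched_pair[OF n]
  interpret regular_order "A j" "D j" using mp(1) by (rule regular_order)
  show ?thesis
  proof (cases "Man b \<in> A j \<and> Man c \<in> A j")
    case True
    have "C j - {Man n} \<subseteq> A j" using mp(5) by blast
    then have "measure_pmf.prob (D' j) {r. (Man b, Man c) \<in> r \<and> (Man c, Man n) \<in> r} \<le>
        measure_pmf.prob (D j) {r. (Man b, Man c) \<in> r}"
      unfolding D'_eq_top_event(1)[OF n]
      using D'_eq_top_event(2)[OF n] mp(3) True bc by (intro prob_chain_given_top_event) auto
    also have "\<dots> \<le> u (b - c)"
      using prob_prefers_later_le(1)[OF mp(1), of c "b - c"] True bc by auto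
    finally show ?thesis .
  next
    case False
    have "measure_pmf.prob (D' j) {r. (Man b, Man c) \<in> r \<and> (Man c, Man n) \<in> r} \<le>
        measure_pmf.prob (D' j) {}"
    proof (rule prob_le_mono_support)
      fix r assume "r \<in> set_pmf (D' j)" and r: "r \<in> {r. (Man b, Man c) \<in> r \<and> (Man c, Man n) \<in> r}"
      then have "r \<in> set_pmf (D j)" using set_D'[OF mp(1)] by simp
      then show "r \<in> {}" using mem_A_if_preferred[OF mp(1)] mp(3) r False by blast
    qed
    then show ?thesis using u_nonneg[of "b - c"] by simp
  qed
qed

text \<open>\<open>lower n\<close> is independent of the list at \<open>n\<close>, the one in which
  crossings are counted. So the left end is fixed first, and the bound holds for each of its
  values.\<close>

lemma expectation_crossings:
  assumes n: "n \<in> {1..M}" "\<mu> (Man n) = Woman j"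
  shows "measure_pmf.expectation (Pi_pmf {1..M} {} E)
    (\<lambda>Q. real (card (crossings n (lower n Q) (Q n)))) \<le> U1"
proof -
  let ?I = "{1..M} - {n}"
  have "partner n = j" "n \<in> matched_men" using n by (auto simp: partner_def matched_men_def)
  then have En: "E n = D' j" by (simp add: E_def)
  have step: "measure_pmf.expectation (E n) (\<lambda>r. real (card (crossings n a r))) \<le> U1" for a
  proof -
    let ?G = "{a..M} \<times> {1..<a}"
    have "real (card (crossings n a r)) =
        (\<Sum>(b, c)\<in>?G. indicator {r. (Man b, Man c) \<in> r \<and> (Man c, Man n) \<in> r} r)" for r
    proof -
      have "real (card (crossings n a r)) = (\<Sum>x\<in>crossings n a r. 1)" by simp
      also have "\<dots> = (\<Sum>(b, c)\<in>?G. indicator {r. (Man b, Man c) \<in> r \<and> (Man c, Man n) \<in> r} r)"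
        by (rule sum.mono_neutral_cong_left) (auto simp: crossings_def indicator_def)
      finally show ?thesis .
    qed
    then have "measure_pmf.expectation (E n) (\<lambda>r. real (card (crossings n a r))) =
        (\<Sum>(b, c)\<in>?G. measure_pmf.prob (D' j) {r. (Man b, Man c) \<in> r \<and> (Man c, Man n) \<in> r})"
      using integrable_measure_pmf_finite[OF finite_E[of n]]
      by (simp add: En case_prod_unfold) (subst Bochner_Integration.integral_sum, simp_all)
    also have "\<dots> \<le> (\<Sum>(b, c)\<in>?G. u (b - c))"
    proof (rule sum_mono, clarify)
      fix b c assume "b \<in> {a..M}" "c \<in> {1..<a}"
      then show "measure_pmf.prob (D' j) {r. (Man b, Man c) \<in> r \<and> (Man c, Man n) \<in> r} \<le> u (b - c)"
        using prob_crossing[OF n, of c b] by auto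
    qed
    also have "\<dots> \<le> U1" unfolding U1_def by (rule sum_differences_across_le[OF u_nonneg])
    finally show ?thesis .
  qed
  have ins: "{1..M} = insert n ?I" using n by auto
  have "lower n (Q(n := r)) = lower n Q" for Q r
    unfolding lower_def by (rule left_end_cong) (use n in auto)
  then have "measure_pmf.expectation (Pi_pmf {1..M} {} E)
      (\<lambda>Q. real (card (crossings n (lower n Q) (Q n)))) =
      measure_pmf.expectation (Pi_pmf ?I {} E)
        (\<lambda>Q. measure_pmf.expectation (E n) (\<lambda>r. real (card (crossings n (lower n Q) r))))"
    by (subst ins, subst expectation_Pi_pmf_insert(2)) (auto simp: finite_E)
  also have "\<dots> \<le> measure_pmf.expectation (Pi_pmf ?I {} E) (\<lambda>Q. U1)"
    by (rule expectation_mono_finite) (auto intro!: finite_set_Pi_pmf finite_E step)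
  finally show ?thesis by simp
qed

text \<open>\<open>stable_rank_gap_le\<close> with the thresholds \<open>lower n Q' - 1\<close> and
  \<open>upper n Q'\<close>, which are closed because the scans end in sets closed under
  jumps.\<close>

lemma gap_le:
  assumes n: "n \<in> {1..M}" "\<mu> (Man n) = Woman j"
    and Q: "Q \<in> set_pmf profiles" "Q \<in> Pi {1..W} K"
  defines "Q' \<equiv> \<lambda>i. if i \<in> matched_men then Q (partner i) else {}"
  shows "stable_rank_gap M W (profile P Q) (Woman j) \<le> real (upper n Q' - n) +
    real (n - lower n Q') + real (card (crossings n (lower n Q') (Q' n)))"
proof -
  note mp = matched_pair[OF n]
  interpret MQ: market M W "profile P Q" using Q(1) by (rule market_profile)
  let ?R = "profile P Q" and ?X = "\<lambda>i. jump i (Q' i)"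
  have closed: "MQ.closed_prefix \<mu> t"
    if t: "\<And>i. i \<in> {1..M} \<Longrightarrow> i \<le> t \<Longrightarrow> i + ?X i \<le> t" for t
    unfolding MQ.closed_prefix_def
  proof (intro allI impI, elim conjE)
    fix i k assume i: "i \<in> {1..M}" "i \<le> t" "\<mu> (Man i) \<noteq> Man i" and k: "(Man k, Man i) \<in> ?R (\<mu> (Man i))"
    have im: "i \<in> matched_men" using i by (simp add: matched_men_def)
    then have pi: "\<mu> (Man i) = Woman (partner i)" by (rule partner)
    have Wp: "partner i \<in> {1..W}" using matched_pair(1)[OF i(1) pi] .
    have kr: "(Man k, Man i) \<in> Q' i" using k pi im by (simp add: Q'_def)
    have "Q (partner i) \<in> set_pmf (D (partner i))" using set_Pi_pmfD[OF Q(1) _ Wp] by simp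
    \<comment> \<open>\<open>closed_prefix\<close> quantifies over all \<open>k\<close>; the bound
      comes from the domain of the list.\<close>
    then have "k \<in> {1..M}"
      using woman_order(4)[OF Wp] k pi by (fastforce simp: men_def)
    moreover have "k - i \<le> ?X i" if "i < k"
      using jump_ge[of "k - i" i "Q' i"] kr that \<open>k \<in> {1..M}\<close> by simp
    ultimately show "k \<le> t" using t[OF i(1,2)] i(2) by linarith
  qed
  have "MQ.closed_prefix \<mu> (upper n Q')"
  proof (rule closed)
    fix i assume "i \<in> {1..M}" "i \<le> upper n Q'"
    then show "i + ?X i \<le> upper n Q'"
      using right_end_closed[of 0 i M ?X n] by (simp add: upper_def)
  qed
  moreover have "n \<le> upper n Q'" unfolding upper_def by (rule right_end_ge)
  moreover have low: "0 < lower n Q'" "lower n Q' \<le> n"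
    using left_end_pos[of n ?X "n - 1"] left_end_le[of "n - 1" n ?X] n(1)
    by (auto simp: lower_def)
  moreover have "MQ.closed_prefix \<mu> (lower n Q' - 1)"
  proof (rule closed)
    fix i assume i: "i \<in> {1..M}" "i \<le> lower n Q' - 1"
    then have "i \<le> n - 1" "i < lower n Q'" using low by auto
    then have "i + ?X i < lower n Q'"
      using left_end_closed[of "n - 1" n i ?X] i(1) n(1) by (simp add: lower_def)
    then show "i + ?X i \<le> lower n Q' - 1" by simp
  qed
  moreover have "Woman j \<in> women W" using mp(1) by (simp add: women_def)
  ultimately have gap: "stable_rank_gap M W ?R (Woman j) \<le> real (upper n Q' - n) +
      real (n - Suc (lower n Q' - 1)) +
      real (card {(b, c). b \<in> {1..M} \<and> c \<in> {1..lower n Q' - 1} \<and> lower n Q' - 1 < b \<and>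
        (Man b, Man c) \<in> ?R (Woman j) \<and> (Man c, Man n) \<in> ?R (Woman j)})"
    by (intro MQ.stable_rank_gap_le[OF optimal_class[OF Q] _ mp(2)]) auto
  have "Q' n = Q j" using n by (simp add: Q'_def matched_men_def partner_def)
  then have "{(b, c). b \<in> {1..M} \<and> c \<in> {1..lower n Q' - 1} \<and> lower n Q' - 1 < b \<and>
      (Man b, Man c) \<in> ?R (Woman j) \<and> (Man c, Man n) \<in> ?R (Woman j)} =
      crossings n (lower n Q') (Q' n)"
    using low(1) by (auto simp: crossings_def)
  moreover have "Suc (lower n Q' - 1) = lower n Q'" using low(1) by simp
  ultimately show ?thesis using gap by simp
qed

lemma expectation_gap_class:
  assumes n: "n \<in> {1..M}" "\<mu> (Man n) = Woman j"
  shows "measure_pmf.expectation (cond_pmf profiles (Pi {1..W} K))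
    (\<lambda>Q. stable_rank_gap M W (profile P Q) (Woman j)) \<le> (1 + 2 * exp U1) * U2"
proof -
  let ?c = "cond_pmf profiles (Pi {1..W} K)"
  let ?red = "\<lambda>Q i. if i \<in> matched_men then Q (partner i) else {}"
  let ?g = "\<lambda>Q. real (upper n Q - n) + real (n - lower n Q) +
    real (card (crossings n (lower n Q) (Q n)))"
  have ne: "set_pmf profiles \<inter> Pi {1..W} K \<noteq> {}" using Q0 by (auto simp: K_def)
  have "measure_pmf.expectation ?c (\<lambda>Q. stable_rank_gap M W (profile P Q) (Woman j)) \<le>
      measure_pmf.expectation ?c (\<lambda>Q. ?g (?red Q))"
  proof (rule expectation_mono_finite)
    show "finite (set_pmf ?c)" using finite_profiles ne by simp
    fix Q assume "Q \<in> set_pmf ?c"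
    then have "Q \<in> set_pmf profiles" "Q \<in> Pi {1..W} K" using ne by auto
    then show "stable_rank_gap M W (profile P Q) (Woman j) \<le> ?g (?red Q)" by (rule gap_le[OF n])
  qed
  also have "\<dots> = measure_pmf.expectation (Pi_pmf {1..M} {} E) ?g"
    unfolding map_profiles_E[symmetric] cond_profiles by simp
  also have "\<dots> = measure_pmf.expectation (Pi_pmf {1..M} {} E) (\<lambda>Q. real (upper n Q - n)) +
      measure_pmf.expectation (Pi_pmf {1..M} {} E) (\<lambda>Q. real (n - lower n Q)) +
      measure_pmf.expectation (Pi_pmf {1..M} {} E) (\<lambda>Q. real (card (crossings n (lower n Q) (Q n))))"
  proof -
    have "finite (set_pmf (Pi_pmf {1..M} {} E))" by (intro finite_set_Pi_pmf finite_E) simp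
    then have "integrable (Pi_pmf {1..M} {} E) f" for f :: "(nat \<Rightarrow> person rel) \<Rightarrow> real"
      by (rule integrable_measure_pmf_finite)
    then show ?thesis by (simp only: Bochner_Integration.integral_add Bochner_Integration.integrable_add)
  qed
  also have "\<dots> \<le> U2 * exp U1 + U2 * exp U1 + U1"
    by (intro add_mono expectation_upper expectation_lower[OF n(1)] expectation_crossings[OF n])
  \<comment> \<open>\<open>U1 \<le> U2\<close> because \<open>k \<le> k^2\<close>.\<close>
  also have "\<dots> \<le> U2 * exp U1 + U2 * exp U1 + U2"
    unfolding U1_def U2_def
    by (intro add_left_mono sum_mono mult_right_mono) (auto simp: u_nonneg power2_eq_square)
  also have "\<dots> = (1 + 2 * exp U1) * U2" by (simp add: algebra_simps)
  finally show ?thesis .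
qed

end

section \<open>Averaging over the conditioning classes\<close>

context random_market
begin

lemma expectation_gap:
  assumes j: "j \<in> {1..W}"
  defines "H \<equiv> {Q. stable_partners M W (profile P Q) (Woman j) \<noteq> {}}"
  assumes ne: "set_pmf profiles \<inter> H \<noteq> {}"
  shows "measure_pmf.expectation (cond_pmf profiles H)
    (\<lambda>Q. stable_rank_gap M W (profile P Q) (Woman j))
    \<le> (1 + 2 * exp (\<Sum>k=1..M. real k * u k)) * (\<Sum>k=1..M. (real k)\<^sup>2 * u k)"
proof -
  define opt where "opt = (\<lambda>Q. THE \<mu>. man_optimal M W (profile P Q) \<mu>)"
  define C where "C = (\<lambda>Q j. proposers M (profile P Q) (opt Q) (Woman j))"
  \<comment> \<open>The second component is blanked outside \<open>{1..W}\<close>, so equality of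
    keys constrains only the actual women.\<close>
  define key where
    "key = (\<lambda>Q. (opt Q, \<lambda>j. if j \<in> {1..W} then Q j \<inter> C Q j \<times> C Q j else {}))"
  have w: "Woman j \<in> women W" using j by (simp add: women_def)
  have opt: "opt Q = \<mu>" if "Q \<in> set_pmf profiles" "man_optimal M W (profile P Q) \<mu>" for Q \<mu>
  proof -
    interpret market M W "profile P Q" using that(1) by (rule market_profile)
    show ?thesis unfolding opt_def using that(2) man_optimal_unique by (intro the_equality) auto
  qed
  show ?thesis
  proof (rule expectation_cond_pmf_partition[OF finite_profiles ne, where key = key])
    fix Q0 assume "Q0 \<in> set_pmf profiles \<inter> H"
    then have Q0: "Q0 \<in> set_pmf profiles" "Q0 \<in> H" by auto
    interpret M0: market M W "profile P Q0" using Q0(1) by (rule market_profile)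
    obtain \<nu> where \<nu>: "stable M W (profile P Q0) \<nu>" "\<nu> (Woman j) \<noteq> Woman j"
      using Q0(2) by (auto simp: H_def stable_partners_def)
    obtain \<mu> where \<mu>: "man_optimal M W (profile P Q0) \<mu>" "\<mu> (Woman j) \<noteq> Woman j"
      using M0.ex_man_optimal[OF \<nu>(1)] \<nu> w by blast
    have st: "stable M W (profile P Q0) \<mu>" using \<mu>(1) by (simp add: man_optimal_def)
    interpret cm: conditioned_market M W A P D u Q0 \<mu>
      by unfold_locales (use Q0(1) \<mu>(1) in auto)
    obtain n where n: "n \<in> {1..M}" "\<mu> (Woman j) = Man n"
      using M0.stable_woman[OF st w \<mu>(2)] by (auto simp: men_def)
    then have n': "\<mu> (Man n) = Woman j" using M0.stable_invol[OF st, of "Woman j"] w by simp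
    have optQ0: "opt Q0 = \<mu>" using opt[OF Q0(1) \<mu>(1)] .
    have CQ0: "C Q0 i = cm.C i" for i by (simp add: C_def cm.C_def optQ0)
    \<comment> \<open>For fixed \<open>\<mu>\<close> the proposers depend only on the men's lists
      and on acceptability, neither of which is random.\<close>
    have props: "proposers M (profile P Q) \<mu> (Woman i) = cm.C i" if Q: "Q \<in> set_pmf profiles" and i: "i \<in> {1..W}" for Q i
    proof -
      have "Q i \<in> set_pmf (D i)" "Q0 i \<in> set_pmf (D i)"
        using set_Pi_pmfD[OF Q _ i] set_Pi_pmfD[OF Q0(1) _ i] by auto
      then have "(m, Woman i) \<in> Q i \<longleftrightarrow> (m, Woman i) \<in> Q0 i" for m
        using mem_A_iff[OF i] by blast
      then show ?thesis by (auto simp: proposers_def cm.C_def men_def)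
    qed
    \<comment> \<open>On the support the class is the product event of \<open>cm.K\<close>.
      Membership in \<open>H\<close> is automatic there, since \<open>\<mu>\<close> is stable
      throughout and matches the woman.\<close>
    have in_class: "Q \<in> {Q \<in> H. key Q = key Q0} \<longleftrightarrow> Q \<in> Pi {1..W} cm.K"
      if Q: "Q \<in> set_pmf profiles" for Q
    proof
      assume "Q \<in> {Q \<in> H. key Q = key Q0}"
      then have kQ: "key Q = key Q0" by simp
      then have oQ: "opt Q = \<mu>" using optQ0 by (simp add: key_def)
      show "Q \<in> Pi {1..W} cm.K"
      proof
        fix i assume i: "i \<in> {1..W}"
        have "snd (key Q) i = snd (key Q0) i" using kQ by simp
        then show "Q i \<in> cm.K i"
          using i props[OF Q i] oQ CQ0 by (simp add: key_def cm.K_def C_def)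
      qed
    next
      assume QK: "Q \<in> Pi {1..W} cm.K"
      then have \<mu>Q: "man_optimal M W (profile P Q) \<mu>" using cm.optimal_class[OF Q] by blast
      then have oQ: "opt Q = \<mu>" using opt[OF Q] by blast
      have "stable M W (profile P Q) \<mu>" using \<mu>Q by (simp add: man_optimal_def)
      then have "Q \<in> H" using \<mu>(2) by (auto simp: H_def stable_partners_def)
      moreover have "key Q = key Q0"
      proof -
        have "Q i \<inter> C Q i \<times> C Q i = Q0 i \<inter> C Q0 i \<times> C Q0 i" if i: "i \<in> {1..W}" for i
          using QK i props[OF Q i] oQ CQ0 by (auto simp: C_def cm.K_def Pi_def)
        then show ?thesis using oQ optQ0 by (simp add: key_def fun_eq_iff)
      qed
      ultimately show "Q \<in> {Q \<in> H. key Q = key Q0}" by simp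
    qed
    have "cond_pmf profiles {Q \<in> H. key Q = key Q0} = cond_pmf profiles (Pi {1..W} cm.K)"
    proof (rule cond_pmf_eqI)
      show "set_pmf profiles \<inter> {Q \<in> H. key Q = key Q0} = set_pmf profiles \<inter> Pi {1..W} cm.K"
        using in_class by blast
      show "set_pmf profiles \<inter> {Q \<in> H. key Q = key Q0} \<noteq> {}" using Q0 by blast
    qed
    then show "measure_pmf.expectation (cond_pmf profiles {Q \<in> H. key Q = key Q0})
        (\<lambda>Q. stable_rank_gap M W (profile P Q) (Woman j))
        \<le> (1 + 2 * exp (\<Sum>k=1..M. real k * u k)) * (\<Sum>k=1..M. (real k)\<^sup>2 * u k)"
      using cm.expectation_gap_class[OF n(1) n'] by (simp add: cm.U1_def cm.U2_def)
  qed
qed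

end

section \<open>From extended to real-valued ratios\<close>

lemma suminf_ennreal_eq_sum:
  assumes "\<And>k. M \<le> k \<Longrightarrow> v (Suc k) = 0" "\<And>k. k < M \<Longrightarrow> v (Suc k) = ennreal (x (Suc k))"
    and "\<And>k. 0 \<le> x k"
  shows "(\<Sum>k. v (Suc k)) = ennreal (\<Sum>k=1..M. x k)"
proof -
  have "(\<Sum>k. v (Suc k)) = (\<Sum>k<M. v (Suc k))"
    using assms(1) by (intro suminf_finite) auto
  also have "\<dots> = (\<Sum>k<M. ennreal (x (Suc k)))" using assms(2) by (intro sum.cong) auto
  also have "\<dots> = ennreal (\<Sum>k<M. x (Suc k))" using assms(3) by (intro sum_ennreal) auto
  also have "(\<Sum>k<M. x (Suc k)) = (\<Sum>k=1..M. x k)" by (simp add: sum.atLeast1_atMost_eq)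
  finally show ?thesis .
qed

lemma max_swap_ratio_ge:
  assumes "j \<in> {1..W}" "1 \<le> i" "i + k \<le> M" "Man i \<in> A j" "Man (i + k) \<in> A j"
  shows "emeasure (measure_pmf (D j)) {r. (Man (i + k), Man i) \<in> r} /
      emeasure (measure_pmf (D j)) {r. (Man i, Man (i + k)) \<in> r} \<le> max_swap_ratio M W A D k"
  unfolding max_swap_ratio_def
proof (rule Max_ge)
  let ?f = "\<lambda>(i, j). emeasure (measure_pmf (D j)) {r. (Man (i + k), Man i) \<in> r} /
      emeasure (measure_pmf (D j)) {r. (Man i, Man (i + k)) \<in> r}"
  show "finite (insert 0 {emeasure (measure_pmf (D j)) {r. (Man (i + k), Man i) \<in> r} /
      emeasure (measure_pmf (D j)) {r. (Man i, Man (i + k)) \<in> r} | i j.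
      j \<in> {1..W} \<and> 1 \<le> i \<and> i + k \<le> M \<and> Man i \<in> A j \<and> Man (i + k) \<in> A j})"
    by (rule finite.insertI, rule finite_subset[of _ "?f ` ({1..M} \<times> {1..W})"]) force+
qed (use assms in blast)

lemma max_swap_ratio_eq_0: "M \<le> k \<Longrightarrow> max_swap_ratio M W A D k = 0"
proof -
  assume "M \<le> k"
  then have "{emeasure (measure_pmf (D j)) {r. (Man (i + k), Man i) \<in> r} /
      emeasure (measure_pmf (D j)) {r. (Man i, Man (i + k)) \<in> r} | i j.
      j \<in> {1..W} \<and> 1 \<le> i \<and> i + k \<le> M \<and> Man i \<in> A j \<and> Man (i + k) \<in> A j} = {}"
    by auto
  then show ?thesis unfolding max_swap_ratio_def by (simp only: Max_singleton)
qed

text \<open>Numerator and denominator add up to 1, so a zero denominator would make the ratio, and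
  hence the maximum, infinite.\<close>

lemma (in random_lists) random_market_max_swap_ratio:
  assumes fin: "\<And>k. 1 \<le> k \<Longrightarrow> max_swap_ratio M W A D k \<noteq> \<infinity>"
  shows "random_market M W A P D (\<lambda>k. enn2real (max_swap_ratio M W A D k))"
proof unfold_locales
  fix i j k :: nat
  assume j: "j \<in> {1..W}" and i: "1 \<le> i" "1 \<le> k" "i + k \<le> M" "Man i \<in> A j" "Man (i + k) \<in> A j"
  interpret regular_order "A j" "D j" using j by (rule regular_order)
  let ?u = "max_swap_ratio M W A D k"
  let ?p = "measure_pmf.prob (D j) {r. (Man (i + k), Man i) \<in> r}"
  let ?q = "measure_pmf.prob (D j) {r. (Man i, Man (i + k)) \<in> r}"
  have le: "ennreal ?p / ennreal ?q \<le> ?u"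
    using max_swap_ratio_ge[where D = D and A = A, OF j i(1,3,4,5)]
    by (simp add: measure_pmf.emeasure_eq_measure)
  have pq: "?p = 1 - ?q" using prob_swap[of "Man (i + k)" "Man i"] i by auto
  have "?q \<noteq> 0"
  proof
    assume "?q = 0"
    then have "ennreal ?p / ennreal ?q = \<infinity>" using pq by (simp add: divide_ennreal_def)
    then show False using le fin[OF i(2)] by (simp add: top_unique)
  qed
  then have q: "0 < ?q" by (simp add: zero_less_measure_iff)
  have "?u < top" using fin[OF i(2)] by (simp add: less_top)
  then have "ennreal (?p / ?q) \<le> ennreal (enn2real ?u)"
    using le q by (simp add: divide_ennreal)
  then have "?p / ?q \<le> enn2real ?u" by (simp add: ennreal_le_iff)
  then show "?p \<le> enn2real ?u * ?q" using q by (simp add: pos_divide_le_eq)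
qed simp

theorem theorem1:
  fixes M W w :: nat
    and A :: "nat \<Rightarrow> person set"
    and P :: "nat \<Rightarrow> person rel"
    and D :: "nat \<Rightarrow> person rel pmf"
  defines "u \<equiv> max_swap_ratio M W A D"
    and "has_partner \<equiv> {R. stable_partners M W R (Woman w) \<noteq> {}}"
  assumes men_prefs: "\<And>i. i \<in> {1..M} \<Longrightarrow> pref_order M W (Man i) (P i)"
    and women_prefs: "\<And>j r. j \<in> {1..W} \<Longrightarrow> r \<in> set_pmf (D j) \<Longrightarrow>
           pref_order M W (Woman j) r \<and> acceptable r (Woman j) = A j"
    and regular: "\<And>j. j \<in> {1..W} \<Longrightarrow> regular (A j) (D j)"
    and w: "w \<in> {1..W}"
    and pos: "measure_pmf.prob (random_profile W P D) has_partner > 0"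
  shows "ennreal (measure_pmf.expectation (cond_pmf (random_profile W P D) has_partner)
             (\<lambda>R. stable_rank_gap M W R (Woman w)))
         \<le> (1 + 2 * exp_ennreal (\<Sum>k. of_nat (Suc k) * u (Suc k))) *
           (\<Sum>k. of_nat (Suc k) ^ 2 * u (Suc k))"
proof (cases "\<forall>k\<ge>1. u k \<noteq> \<infinity>")
  case True
  interpret random_lists M W A P D
    using men_prefs women_prefs regular by unfold_locales
  define v where "v = (\<lambda>k. enn2real (u k))"
  interpret random_market M W A P D v
    using random_market_max_swap_ratio True unfolding v_def u_def by simp
  define H where "H = {Q. stable_partners M W (profile P Q) (Woman w) \<noteq> {}}"
  let ?U1 = "\<Sum>k=1..M. real k * v k" and ?U2 = "\<Sum>k=1..M. (real k)\<^sup>2 * v k"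
  have vim: "profile P -` has_partner = H" by (auto simp: H_def has_partner_def)
  have "measure_pmf.prob profiles H > 0"
    using pos by (simp add: random_profile_def vim)
  then have ne: "set_pmf profiles \<inter> H \<noteq> {}"
    by (metis less_irrefl measure_Int_set_pmf measure_empty inf_commute)
  have uv: "u k = ennreal (v k)" if "1 \<le> k" for k
    using True that by (simp add: v_def less_top)
  have u0: "M \<le> k \<Longrightarrow> u (Suc k) = 0" for k by (simp add: u_def max_swap_ratio_eq_0)
  have v0: "M \<le> k \<Longrightarrow> v (Suc k) = 0" for k by (simp add: v_def u0)
  have s1: "(\<Sum>k. of_nat (Suc k) * u (Suc k)) = ennreal ?U1"
    by (rule suminf_ennreal_eq_sum[of M "\<lambda>k. of_nat k * u k" "\<lambda>k. real k * v k"])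
      (simp_all add: v0 uv u_nonneg ennreal_mult ennreal_of_nat_eq_real_of_nat del: of_nat_Suc)
  have s2: "(\<Sum>k. of_nat (Suc k) ^ 2 * u (Suc k)) = ennreal ?U2"
    by (rule suminf_ennreal_eq_sum[of M "\<lambda>k. of_nat k ^ 2 * u k" "\<lambda>k. (real k)\<^sup>2 * v k"])
      (simp_all add: v0 uv u_nonneg ennreal_mult ennreal_of_nat_eq_real_of_nat
        flip: ennreal_power del: of_nat_Suc)
  have U: "0 \<le> ?U1" "0 \<le> ?U2" by (intro sum_nonneg; simp add: u_nonneg)+
  have "cond_pmf (random_profile W P D) has_partner = map_pmf (profile P) (cond_pmf profiles H)"
    unfolding random_profile_def using ne by (subst cond_map_pmf) (simp_all add: vim)
  then have "measure_pmf.expectation (cond_pmf (random_profile W P D) has_partner)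
      (\<lambda>R. stable_rank_gap M W R (Woman w)) \<le> (1 + 2 * exp ?U1) * ?U2"
    using expectation_gap[OF w] ne by (simp add: H_def)
  then have "ennreal (measure_pmf.expectation (cond_pmf (random_profile W P D) has_partner)
      (\<lambda>R. stable_rank_gap M W R (Woman w))) \<le> ennreal ((1 + 2 * exp ?U1) * ?U2)"
    by (rule ennreal_leI)
  also have "\<dots> = (1 + 2 * exp_ennreal (ennreal ?U1)) * ennreal ?U2"
    using U by (simp add: exp_ennreal_def ennreal_mult ennreal_plus flip: ennreal_1 ennreal_numeral)
  finally show ?thesis unfolding s1 s2 .
next
  case False
  \<comment> \<open>An infinite ratio makes the second series infinite; the first factor is at least
    1, so the right-hand side is infinite.\<close>
  then obtain k where k: "1 \<le> k" "u k = \<infinity>" by blast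
  then obtain k' where k': "k = Suc k'" by (cases k) auto
  have "of_nat (Suc k') ^ 2 * u (Suc k') \<le> (\<Sum>k. of_nat (Suc k) ^ 2 * u (Suc k))"
    using sum_le_suminf[of "\<lambda>k. of_nat (Suc k) ^ 2 * u (Suc k)" "{k'}"] by simp
  moreover have "of_nat (Suc k') ^ 2 * u (Suc k') = \<infinity>"
    using k k' by (simp add: ennreal_mult_top del: of_nat_Suc)
  ultimately have "(\<Sum>k. of_nat (Suc k) ^ 2 * u (Suc k)) = \<infinity>" by (simp add: top_unique)
  then show ?thesis by (simp add: ennreal_mult_top)
qed

end
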